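(* Let $\chi\colon\mathbb T\mathbb S\to\mathbb S\mathbb T$ be a comonad distributive law between comonads $\mathbb T=(T,\Delta^T,\epsilon^T)$ and $\mathbb S=(S,\Delta^S,\epsilon^S)$ on a category $\mathcal B$, and let $(M,\mathcal Y,\rho)$ be a right $\chi$-coalgebra and $(N,\mathcal Z,\lambda)$ a left $\chi$-coalgebra. Suppose also that $\mathcal Z$ is an abelian category. If either of $(N,\mathcal Z,\lambda)$, $(M,\mathcal Y,\rho)$ is entwined, then the chain complexes associated to both $\mathrm C_{\mathbb T}(N,M)$ and $\mathrm C^{\mathrm{op}}_{\mathbb S}(N,M)$ are contractible.
   Context: Juxtaposition denotes composition of functors and whiskering. A comonad distributive law $\chi\colon\mathbb T\mathbb S\to\mathbb S\mathbb T$ is a natural transformation $\chi\colon TS\to ST$ with $S\epsilon^T\circ\chi=\epsilon^TS$, $S\Delta^T\circ\chi=\chi T\circ T\chi\circ\Delta^TS$, $\epsilon^ST\circ\chi=T\epsilon^S$, $\Delta^ST\circ\chi=S\chi\circ\chi S\circ T\Delta^S$. A right $\chi$-coalgebra $(M,\mathcal Y,\rho)$ is a functor $M\colon\mathcal Y\to\mathcal B$ with a natural transformation $\rho\colon TM\to SM$ such that $\epsilon^SM\circ\rho=\epsilon^TM$ and $\Delta^SM\circ\rho=S\rho\circ\chi M\circ T\rho\circ\Delta^TM$. It is entwined if $\rho=\nabla^S\circ\epsilon^TM$ for some $\mathbb S$-coalgebra structure $\nabla^S\colon M\to SM$ (i.e. $\Delta^SM\circ\nabla^S=S\nabla^S\circ\nabla^S$,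 $\epsilon^SM\circ\nabla^S=\mathrm{id}$). A left $\chi$-coalgebra $(N,\mathcal Z,\lambda)$ is a functor $N\colon\mathcal B\to\mathcal Z$ with a natural transformation $\lambda\colon NS\to NT$ such that $N\epsilon^T\circ\lambda=N\epsilon^S$ and $N\Delta^T\circ\lambda=\lambda T\circ N\chi\circ\lambda S\circ N\Delta^S$. It is entwined if $\lambda=\nabla^T\circ N\epsilon^S$ for some $\mathbb T$-opcoalgebra structure $\nabla^T\colon N\to NT$ (i.e. $N\Delta^T\circ\nabla^T=\nabla^TT\circ\nabla^T$, $N\epsilon^T\circ\nabla^T=\mathrm{id}$). $\mathrm C_{\mathbb T}(N,M)$ is the simplicial functor $\mathcal Y\to\mathcal Z$ with $\mathrm C_{\mathbb T}(N,M)_n=NT^{n+1}M$, $d_i=NT^i\epsilon^TT^{n-i}M$, $s_j=NT^j\Delta^TT^{n-j}M$. $\mathrm C^{\mathrm{op}}_{\mathbb S}(N,M)$ is the simplicial functor with $\mathrm C^{\mathrm{op}}_{\mathbb S}(N,M)_n=NS^{n+1}M$, $d_i=NS^{n-i}\epsilon^SS^iM$, $s_j=NS^{n-j}\Delta^SS^jM$. The associated chain complex has boundary $b=\sum_{i=0}^n(-1)^id_i$ in degree $n$; it is a complex of functors $\mathcal Y\to\mathcal Z$.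
   Formalization: Contractibility is proved for the associated chain complexes augmented by NεM to NM in degree −1; the unaugmented complexes are not contractible in general (with all comonads, functors and transformations identities, H_0 = X is nonzero). *)

theory Defs
  imports "HOL-Algebra.FiniteProduct"
begin

section \<open>Categories, functors, natural transformations\<close>

record ('o, 'm) cat =
  Ob :: "'o set"
  Ar :: "'m set"
  Dom :: "'m \<Rightarrow> 'o"
  Cod :: "'m \<Rightarrow> 'o"
  Ide :: "'o \<Rightarrow> 'm"
  Cmp :: "'m \<Rightarrow> 'm \<Rightarrow> 'm"  (infixr "\<cdot>\<index>" 70)

definition hom_set :: "('o, 'm, 'x) cat_scheme \<Rightarrow> 'o \<Rightarrow> 'o \<Rightarrow> 'm set" where
  "hom_set C a b = {f \<in> Ar C. Dom C f = a \<and> Cod C f = b}"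

locale category =
  fixes C :: "('o, 'm, 'x) cat_scheme" (structure)
  assumes Dom_closed: "f \<in> Ar C \<Longrightarrow> Dom C f \<in> Ob C"
    and Cod_closed: "f \<in> Ar C \<Longrightarrow> Cod C f \<in> Ob C"
    and Ide_closed: "a \<in> Ob C \<Longrightarrow> Ide C a \<in> hom_set C a a"
    and Cmp_closed: "\<lbrakk>f \<in> hom_set C a b; g \<in> hom_set C b c\<rbrakk> \<Longrightarrow> g \<cdot> f \<in> hom_set C a c"
    and Cmp_assoc: "\<lbrakk>f \<in> hom_set C a b; g \<in> hom_set C b c; h \<in> hom_set C c d\<rbrakk>
      \<Longrightarrow> (h \<cdot> g) \<cdot> f = h \<cdot> (g \<cdot> f)"
    and Cmp_Ide_left: "f \<in> hom_set C a b \<Longrightarrow> Ide C b \<cdot> f = f"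
    and Cmp_Ide_right: "f \<in> hom_set C a b \<Longrightarrow> f \<cdot> Ide C a = f"

record ('o1, 'm1, 'o2, 'm2) fnctr =
  fobj :: "'o1 \<Rightarrow> 'o2"
  farr :: "'m1 \<Rightarrow> 'm2"

locale is_functor = A: category A + B: category B
  for A :: "('o1, 'm1, 'x1) cat_scheme" and B :: "('o2, 'm2, 'x2) cat_scheme" +
  fixes F :: "('o1, 'm1, 'o2, 'm2) fnctr"
  assumes fobj_closed: "a \<in> Ob A \<Longrightarrow> fobj F a \<in> Ob B"
    and farr_closed: "f \<in> hom_set A a b \<Longrightarrow> farr F f \<in> hom_set B (fobj F a) (fobj F b)"
    and farr_Ide: "a \<in> Ob A \<Longrightarrow> farr F (Ide A a) = Ide B (fobj F a)"
    and farr_Cmp: "\<lbrakk>f \<in> hom_set A a b; g \<in> hom_set A b c\<rbrakk>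
      \<Longrightarrow> farr F (g \<cdot>\<^bsub>A\<^esub> f) = farr F g \<cdot>\<^bsub>B\<^esub> farr F f"

definition fid :: "('o, 'm, 'o, 'm) fnctr" where
  "fid = \<lparr>fobj = \<lambda>a. a, farr = \<lambda>f. f\<rparr>"

definition fcomp :: "('o2, 'm2, 'o3, 'm3) fnctr \<Rightarrow> ('o1, 'm1, 'o2, 'm2) fnctr
    \<Rightarrow> ('o1, 'm1, 'o3, 'm3) fnctr"  (infixr "\<odot>" 75) where
  "G \<odot> F = \<lparr>fobj = \<lambda>a. fobj G (fobj F a), farr = \<lambda>f. farr G (farr F f)\<rparr>"

primrec fpow :: "('o, 'm, 'o, 'm) fnctr \<Rightarrow> nat \<Rightarrow> ('o, 'm, 'o, 'm) fnctr" where
  "fpow T 0 = fid"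
| "fpow T (Suc n) = T \<odot> fpow T n"

text \<open>Natural transformations are represented by their families of components. Values outside
  the objects of the source category are irrelevant, so equations between natural transformations
  are always stated componentwise on objects.\<close>

locale nat_trans = F: is_functor A B F + G: is_functor A B G
  for A :: "('o1, 'm1, 'x1) cat_scheme" and B :: "('o2, 'm2, 'x2) cat_scheme"
    and F :: "('o1, 'm1, 'o2, 'm2) fnctr" and G :: "('o1, 'm1, 'o2, 'm2) fnctr" +
  fixes \<alpha> :: "'o1 \<Rightarrow> 'm2"
  assumes component: "a \<in> Ob A \<Longrightarrow> \<alpha> a \<in> hom_set B (fobj F a) (fobj G a)"
    and naturality: "f \<in> hom_set A a b \<Longrightarrow> \<alpha> b \<cdot>\<^bsub>B\<^esub> farr F f = farr G f \<cdot>\<^bsub>B\<^esub> \<alpha> a"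

text \<open>The two-sided whiskering \<open>G\<alpha>F\<close>.\<close>

definition whisker :: "('o2, 'm2, 'o3, 'm3) fnctr \<Rightarrow> ('o \<Rightarrow> 'm2) \<Rightarrow> ('o1, 'm1, 'o, 'm) fnctr
    \<Rightarrow> 'o1 \<Rightarrow> 'm3" where
  "whisker G \<alpha> F = (\<lambda>a. farr G (\<alpha> (fobj F a)))"


section \<open>Comonads, distributive laws and their coalgebras\<close>

record ('o, 'm) cmnd =
  Fun :: "('o, 'm, 'o, 'm) fnctr"
  cmult :: "'o \<Rightarrow> 'm"
  counit :: "'o \<Rightarrow> 'm"

locale comonad =
  comu: nat_trans B B "Fun T" "Fun T \<odot> Fun T" "cmult T" + coun: nat_trans B B "Fun T" fid "counit T"
  for B :: "('o, 'm, 'x) cat_scheme" and T :: "('o, 'm) cmnd" +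
  assumes coassoc: "a \<in> Ob B \<Longrightarrow>
      farr (Fun T) (cmult T a) \<cdot>\<^bsub>B\<^esub> cmult T a = cmult T (fobj (Fun T) a) \<cdot>\<^bsub>B\<^esub> cmult T a"
    and counit_left: "a \<in> Ob B \<Longrightarrow>
      counit T (fobj (Fun T) a) \<cdot>\<^bsub>B\<^esub> cmult T a = Ide B (fobj (Fun T) a)"
    and counit_right: "a \<in> Ob B \<Longrightarrow>
      farr (Fun T) (counit T a) \<cdot>\<^bsub>B\<^esub> cmult T a = Ide B (fobj (Fun T) a)"

locale distributive_law =
  T: comonad B T + S: comonad B S + chi: nat_trans B B "Fun T \<odot> Fun S" "Fun S \<odot> Fun T" \<chi>
  for B :: "('o, 'm, 'x) cat_scheme" and T :: "('o, 'm) cmnd" and S :: "('o, 'm) cmnd"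
    and \<chi> :: "'o \<Rightarrow> 'm" +
  assumes counit_T: "a \<in> Ob B \<Longrightarrow>
      farr (Fun S) (counit T a) \<cdot>\<^bsub>B\<^esub> \<chi> a = counit T (fobj (Fun S) a)"
    and cmult_T: "a \<in> Ob B \<Longrightarrow>
      farr (Fun S) (cmult T a) \<cdot>\<^bsub>B\<^esub> \<chi> a
        = \<chi> (fobj (Fun T) a) \<cdot>\<^bsub>B\<^esub> farr (Fun T) (\<chi> a) \<cdot>\<^bsub>B\<^esub> cmult T (fobj (Fun S) a)"
    and counit_S: "a \<in> Ob B \<Longrightarrow>
      counit S (fobj (Fun T) a) \<cdot>\<^bsub>B\<^esub> \<chi> a = farr (Fun T) (counit S a)"
    and cmult_S: "a \<in> Ob B \<Longrightarrow>
      cmult S (fobj (Fun T) a) \<cdot>\<^bsub>B\<^esub> \<chi> a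
        = farr (Fun S) (\<chi> a) \<cdot>\<^bsub>B\<^esub> \<chi> (fobj (Fun S) a) \<cdot>\<^bsub>B\<^esub> farr (Fun T) (cmult S a)"

locale right_coalgebra =
  chi: distributive_law B T S \<chi> + M: is_functor Y B M +
  rho: nat_trans Y B "Fun T \<odot> M" "Fun S \<odot> M" \<rho>
  for B :: "('o, 'm, 'x) cat_scheme" and T :: "('o, 'm) cmnd" and S :: "('o, 'm) cmnd"
    and \<chi> :: "'o \<Rightarrow> 'm"
    and M :: "('oy, 'my, 'o, 'm) fnctr" and Y :: "('oy, 'my, 'y) cat_scheme" and \<rho> :: "'oy \<Rightarrow> 'm" +
  assumes counit_rho: "y \<in> Ob Y \<Longrightarrow>
      counit S (fobj M y) \<cdot>\<^bsub>B\<^esub> \<rho> y = counit T (fobj M y)"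
    and cmult_rho: "y \<in> Ob Y \<Longrightarrow>
      cmult S (fobj M y) \<cdot>\<^bsub>B\<^esub> \<rho> y
        = farr (Fun S) (\<rho> y) \<cdot>\<^bsub>B\<^esub> \<chi> (fobj M y) \<cdot>\<^bsub>B\<^esub> farr (Fun T) (\<rho> y) \<cdot>\<^bsub>B\<^esub> cmult T (fobj M y)"

locale left_coalgebra =
  chi: distributive_law B T S \<chi> + N: is_functor B Z N +
  lam_nt: nat_trans B Z "N \<odot> Fun S" "N \<odot> Fun T" lam
  for B :: "('o, 'm, 'x) cat_scheme" and T :: "('o, 'm) cmnd" and S :: "('o, 'm) cmnd"
    and \<chi> :: "'o \<Rightarrow> 'm"
    and N :: "('o, 'm, 'oz, 'mz) fnctr" and Z :: "('oz, 'mz, 'z) cat_scheme" and lam :: "'o \<Rightarrow> 'mz" +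
  assumes counit_lam: "a \<in> Ob B \<Longrightarrow>
      farr N (counit T a) \<cdot>\<^bsub>Z\<^esub> lam a = farr N (counit S a)"
    and cmult_lam: "a \<in> Ob B \<Longrightarrow>
      farr N (cmult T a) \<cdot>\<^bsub>Z\<^esub> lam a
        = lam (fobj (Fun T) a) \<cdot>\<^bsub>Z\<^esub> farr N (\<chi> a) \<cdot>\<^bsub>Z\<^esub> lam (fobj (Fun S) a) \<cdot>\<^bsub>Z\<^esub> farr N (cmult S a)"

text \<open>An \<open>S\<close>-coalgebra structure \<open>M \<rightarrow> SM\<close> on a functor \<open>M\<close> into \<open>B\<close>.\<close>

locale coalgebra_structure =
  S: comonad B S + nab: nat_trans Y B M "Fun S \<odot> M" nabla
  for B :: "('o, 'm, 'x) cat_scheme" and S :: "('o, 'm) cmnd"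
    and M :: "('oy, 'my, 'o, 'm) fnctr" and Y :: "('oy, 'my, 'y) cat_scheme"
    and nabla :: "'oy \<Rightarrow> 'm" +
  assumes cmult_nabla: "y \<in> Ob Y \<Longrightarrow>
      cmult S (fobj M y) \<cdot>\<^bsub>B\<^esub> nabla y = farr (Fun S) (nabla y) \<cdot>\<^bsub>B\<^esub> nabla y"
    and counit_nabla: "y \<in> Ob Y \<Longrightarrow> counit S (fobj M y) \<cdot>\<^bsub>B\<^esub> nabla y = Ide B (fobj M y)"

text \<open>A \<open>T\<close>-opcoalgebra structure \<open>N \<rightarrow> NT\<close> on a functor \<open>N\<close> out of \<open>B\<close>.\<close>

locale opcoalgebra_structure =
  T: comonad B T + nab: nat_trans B Z N "N \<odot> Fun T" nabla
  for B :: "('o, 'm, 'x) cat_scheme" and T :: "('o, 'm) cmnd"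
    and N :: "('o, 'm, 'oz, 'mz) fnctr" and Z :: "('oz, 'mz, 'z) cat_scheme"
    and nabla :: "'o \<Rightarrow> 'mz" +
  assumes cmult_nabla: "a \<in> Ob B \<Longrightarrow>
      farr N (cmult T a) \<cdot>\<^bsub>Z\<^esub> nabla a = nabla (fobj (Fun T) a) \<cdot>\<^bsub>Z\<^esub> nabla a"
    and counit_nabla: "a \<in> Ob B \<Longrightarrow> farr N (counit T a) \<cdot>\<^bsub>Z\<^esub> nabla a = Ide Z (fobj N a)"

definition entwined_right ::
  "('o, 'm, 'x) cat_scheme \<Rightarrow> ('o, 'm) cmnd \<Rightarrow> ('o, 'm) cmnd \<Rightarrow> ('oy, 'my, 'o, 'm) fnctr
    \<Rightarrow> ('oy, 'my, 'y) cat_scheme \<Rightarrow> ('oy \<Rightarrow> 'm) \<Rightarrow> bool" where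
  "entwined_right B T S M Y \<rho> \<longleftrightarrow>
    (\<exists>nabla. coalgebra_structure B S M Y nabla \<and>
      (\<forall>y\<in>Ob Y. \<rho> y = nabla y \<cdot>\<^bsub>B\<^esub> counit T (fobj M y)))"

definition entwined_left ::
  "('o, 'm, 'x) cat_scheme \<Rightarrow> ('o, 'm) cmnd \<Rightarrow> ('o, 'm) cmnd \<Rightarrow> ('o, 'm, 'oz, 'mz) fnctr
    \<Rightarrow> ('oz, 'mz, 'z) cat_scheme \<Rightarrow> ('o \<Rightarrow> 'mz) \<Rightarrow> bool" where
  "entwined_left B T S N Z lam \<longleftrightarrow>
    (\<exists>nabla. opcoalgebra_structure B T N Z nabla \<and>
      (\<forall>a\<in>Ob B. lam a = nabla a \<cdot>\<^bsub>Z\<^esub> farr N (counit S a)))"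


section \<open>Abelian categories\<close>

record ('o, 'm) abcat = "('o, 'm) cat" +
  Add :: "'m \<Rightarrow> 'm \<Rightarrow> 'm"
  Nul :: "'o \<Rightarrow> 'o \<Rightarrow> 'm"

text \<open>The hom-groups are written additively in mathematics, but are groups in the sense of
  \<open>HOL-Algebra\<close>, whose notation is multiplicative: \<open>finprod\<close> is a finite sum, and
  \<open>[^]\<close> is multiplication by an integer.\<close>

definition hom_group :: "('o, 'm, 'x) abcat_scheme \<Rightarrow> 'o \<Rightarrow> 'o \<Rightarrow> 'm monoid" where
  "hom_group C a b = \<lparr>carrier = hom_set C a b, mult = Add C, one = Nul C a b\<rparr>"

definition zero_object :: "('o, 'm, 'x) cat_scheme \<Rightarrow> 'o \<Rightarrow> bool" where
  "zero_object C z \<longleftrightarrow> z \<in> Ob C \<and>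
    (\<forall>a\<in>Ob C. (\<exists>!f. f \<in> hom_set C a z) \<and> (\<exists>!f. f \<in> hom_set C z a))"

definition is_biproduct ::
  "('o, 'm, 'x) abcat_scheme \<Rightarrow> 'o \<Rightarrow> 'o \<Rightarrow> 'o \<Rightarrow> 'm \<Rightarrow> 'm \<Rightarrow> 'm \<Rightarrow> 'm \<Rightarrow> bool" where
  "is_biproduct C a b p \<pi>\<^sub>1 \<pi>\<^sub>2 \<iota>\<^sub>1 \<iota>\<^sub>2 \<longleftrightarrow> p \<in> Ob C \<and>
    \<pi>\<^sub>1 \<in> hom_set C p a \<and> \<pi>\<^sub>2 \<in> hom_set C p b \<and> \<iota>\<^sub>1 \<in> hom_set C a p \<and> \<iota>\<^sub>2 \<in> hom_set C b p \<and>
    \<pi>\<^sub>1 \<cdot>\<^bsub>C\<^esub> \<iota>\<^sub>1 = Ide C a \<and> \<pi>\<^sub>2 \<cdot>\<^bsub>C\<^esub> \<iota>\<^sub>2 = Ide C b \<and>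
    Add C (\<iota>\<^sub>1 \<cdot>\<^bsub>C\<^esub> \<pi>\<^sub>1) (\<iota>\<^sub>2 \<cdot>\<^bsub>C\<^esub> \<pi>\<^sub>2) = Ide C p"

definition is_mono :: "('o, 'm, 'x) cat_scheme \<Rightarrow> 'm \<Rightarrow> bool" where
  "is_mono C f \<longleftrightarrow> f \<in> Ar C \<and>
    (\<forall>a. \<forall>g\<in>hom_set C a (Dom C f). \<forall>h\<in>hom_set C a (Dom C f). f \<cdot>\<^bsub>C\<^esub> g = f \<cdot>\<^bsub>C\<^esub> h \<longrightarrow> g = h)"

definition is_epi :: "('o, 'm, 'x) cat_scheme \<Rightarrow> 'm \<Rightarrow> bool" where
  "is_epi C f \<longleftrightarrow> f \<in> Ar C \<and>
    (\<forall>a. \<forall>g\<in>hom_set C (Cod C f) a. \<forall>h\<in>hom_set C (Cod C f) a. g \<cdot>\<^bsub>C\<^esub> f = h \<cdot>\<^bsub>C\<^esub> f \<longrightarrow> g = h)"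

definition is_kernel :: "('o, 'm, 'x) abcat_scheme \<Rightarrow> 'm \<Rightarrow> 'm \<Rightarrow> bool" where
  "is_kernel C f k \<longleftrightarrow> f \<in> Ar C \<and> k \<in> Ar C \<and> Cod C k = Dom C f \<and>
    f \<cdot>\<^bsub>C\<^esub> k = Nul C (Dom C k) (Cod C f) \<and>
    (\<forall>a. \<forall>g\<in>hom_set C a (Dom C f). f \<cdot>\<^bsub>C\<^esub> g = Nul C a (Cod C f) \<longrightarrow>
      (\<exists>!u. u \<in> hom_set C a (Dom C k) \<and> k \<cdot>\<^bsub>C\<^esub> u = g))"

definition is_cokernel :: "('o, 'm, 'x) abcat_scheme \<Rightarrow> 'm \<Rightarrow> 'm \<Rightarrow> bool" where
  "is_cokernel C f q \<longleftrightarrow> f \<in> Ar C \<and> q \<in> Ar C \<and> Dom C q = Cod C f \<and>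
    q \<cdot>\<^bsub>C\<^esub> f = Nul C (Dom C f) (Cod C q) \<and>
    (\<forall>a. \<forall>g\<in>hom_set C (Cod C f) a. g \<cdot>\<^bsub>C\<^esub> f = Nul C (Dom C f) a \<longrightarrow>
      (\<exists>!u. u \<in> hom_set C (Cod C q) a \<and> u \<cdot>\<^bsub>C\<^esub> q = g))"

locale abelian_category = category C
  for C :: "('o, 'm, 'x) abcat_scheme" (structure) +
  assumes hom_comm_group: "\<lbrakk>a \<in> Ob C; b \<in> Ob C\<rbrakk> \<Longrightarrow> comm_group (hom_group C a b)"
    and Cmp_Add_right: "\<lbrakk>f \<in> hom_set C a b; f' \<in> hom_set C a b; g \<in> hom_set C b c\<rbrakk>
      \<Longrightarrow> g \<cdot> Add C f f' = Add C (g \<cdot> f) (g \<cdot> f')"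
    and Cmp_Add_left: "\<lbrakk>f \<in> hom_set C a b; g \<in> hom_set C b c; g' \<in> hom_set C b c\<rbrakk>
      \<Longrightarrow> Add C g g' \<cdot> f = Add C (g \<cdot> f) (g' \<cdot> f)"
    and zero_object_ex: "\<exists>z. zero_object C z"
    and biproduct_ex: "\<lbrakk>a \<in> Ob C; b \<in> Ob C\<rbrakk> \<Longrightarrow> \<exists>p \<pi>\<^sub>1 \<pi>\<^sub>2 \<iota>\<^sub>1 \<iota>\<^sub>2. is_biproduct C a b p \<pi>\<^sub>1 \<pi>\<^sub>2 \<iota>\<^sub>1 \<iota>\<^sub>2"
    and kernel_ex: "f \<in> Ar C \<Longrightarrow> \<exists>k. is_kernel C f k"
    and cokernel_ex: "f \<in> Ar C \<Longrightarrow> \<exists>q. is_cokernel C f q"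
    and mono_is_kernel: "is_mono C k \<Longrightarrow> \<exists>f. is_kernel C f k"
    and epi_is_cokernel: "is_epi C q \<Longrightarrow> \<exists>f. is_cokernel C f q"


section \<open>Simplicial functors and chain complexes of functors\<close>

text \<open>In degree \<open>n\<close>, \<open>face X n i\<close> is \<open>d\<^sub>i : X\<^sub>n \<rightarrow> X\<^sub>n\<^sub>-\<^sub>1\<close> (for \<open>n \<ge> 1\<close> and \<open>i \<le> n\<close>)
  and \<open>degen X n j\<close> is \<open>s\<^sub>j : X\<^sub>n \<rightarrow> X\<^sub>n\<^sub>+\<^sub>1\<close> (for \<open>j \<le> n\<close>).\<close>

record ('oy, 'my, 'oz, 'mz) simp =
  sobj :: "nat \<Rightarrow> ('oy, 'my, 'oz, 'mz) fnctr"
  face :: "nat \<Rightarrow> nat \<Rightarrow> 'oy \<Rightarrow> 'mz"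
  degen :: "nat \<Rightarrow> nat \<Rightarrow> 'oy \<Rightarrow> 'mz"

definition C_simp :: "('o, 'm) cmnd \<Rightarrow> ('o, 'm, 'oz, 'mz) fnctr \<Rightarrow> ('oy, 'my, 'o, 'm) fnctr
    \<Rightarrow> ('oy, 'my, 'oz, 'mz) simp" where
  "C_simp T N M = \<lparr>
    sobj = \<lambda>n. N \<odot> fpow (Fun T) (n + 1) \<odot> M,
    face = \<lambda>n i. whisker (N \<odot> fpow (Fun T) i) (counit T) (fpow (Fun T) (n - i) \<odot> M),
    degen = \<lambda>n j. whisker (N \<odot> fpow (Fun T) j) (cmult T) (fpow (Fun T) (n - j) \<odot> M)\<rparr>"

definition Cop_simp :: "('o, 'm) cmnd \<Rightarrow> ('o, 'm, 'oz, 'mz) fnctr \<Rightarrow> ('oy, 'my, 'o, 'm) fnctr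
    \<Rightarrow> ('oy, 'my, 'oz, 'mz) simp" where
  "Cop_simp S N M = \<lparr>
    sobj = \<lambda>n. N \<odot> fpow (Fun S) (n + 1) \<odot> M,
    face = \<lambda>n i. whisker (N \<odot> fpow (Fun S) (n - i)) (counit S) (fpow (Fun S) i \<odot> M),
    degen = \<lambda>n j. whisker (N \<odot> fpow (Fun S) (n - j)) (cmult S) (fpow (Fun S) j \<odot> M)\<rparr>"

text \<open>Non-negatively graded; \<open>bdry X n\<close> is the boundary \<open>X\<^sub>n\<^sub>+\<^sub>1 \<rightarrow> X\<^sub>n\<close>.\<close>

record ('oy, 'my, 'oz, 'mz) cplx =
  chain :: "nat \<Rightarrow> ('oy, 'my, 'oz, 'mz) fnctr"
  bdry :: "nat \<Rightarrow> 'oy \<Rightarrow> 'mz"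

locale chain_complex = abelian_category Z
  for Y :: "('oy, 'my, 'y) cat_scheme" and Z :: "('oz, 'mz, 'z) abcat_scheme"
    and X :: "('oy, 'my, 'oz, 'mz) cplx" +
  assumes chain_functor: "is_functor Y Z (chain X n)"
    and bdry_nat_trans: "nat_trans Y Z (chain X (Suc n)) (chain X n) (bdry X n)"
    and bdry_bdry: "y \<in> Ob Y \<Longrightarrow>
      bdry X n y \<cdot>\<^bsub>Z\<^esub> bdry X (Suc n) y = Nul Z (fobj (chain X (Suc (Suc n))) y) (fobj (chain X n) y)"

text \<open>The identity is chain homotopic to zero, in the category of functors \<open>Y \<rightarrow> Z\<close>: the
  contracting homotopy \<open>h\<close> is natural.\<close>

definition contractible_complex ::
  "('oy, 'my, 'y) cat_scheme \<Rightarrow> ('oz, 'mz, 'z) abcat_scheme \<Rightarrow> ('oy, 'my, 'oz, 'mz) cplx \<Rightarrow> bool" where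
  "contractible_complex Y Z X \<longleftrightarrow> chain_complex Y Z X \<and>
    (\<exists>h. (\<forall>n. nat_trans Y Z (chain X n) (chain X (Suc n)) (h n)) \<and>
      (\<forall>y\<in>Ob Y. bdry X 0 y \<cdot>\<^bsub>Z\<^esub> h 0 y = Ide Z (fobj (chain X 0) y)) \<and>
      (\<forall>n. \<forall>y\<in>Ob Y. Add Z (bdry X (Suc n) y \<cdot>\<^bsub>Z\<^esub> h (Suc n) y) (h n y \<cdot>\<^bsub>Z\<^esub> bdry X n y)
        = Ide Z (fobj (chain X (Suc n)) y)))"

text \<open>The boundary is \<open>b = \<Sum> (-1)\<^sup>i d\<^sub>i\<close>, the sum being over \<open>i = 0, \<dots>, n + 1\<close> on degree \<open>n + 1\<close>.\<close>

definition associated_complex ::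
  "('oz, 'mz, 'z) abcat_scheme \<Rightarrow> ('oy, 'my, 'oz, 'mz) simp \<Rightarrow> ('oy, 'my, 'oz, 'mz) cplx" where
  "associated_complex Z X = \<lparr>
    chain = sobj X,
    bdry = \<lambda>n y.
      let H = hom_group Z (fobj (sobj X (Suc n)) y) (fobj (sobj X n) y)
      in finprod H (\<lambda>i. face X (Suc n) i y [^]\<^bsub>H\<^esub> ((-1::int) ^ i)) {0..Suc n}\<rparr>"

text \<open>The augmentation \<open>\<dots> \<rightarrow> X\<^sub>1 \<rightarrow> X\<^sub>0 \<rightarrow> A \<rightarrow> 0\<close> of a complex along \<open>\<epsilon> : X\<^sub>0 \<rightarrow> A\<close>; the degrees
  of \<open>X\<close> are shifted by one.

  It is needed because the unaugmented complex of a comonad has, in general, nonzero homology in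
  degree 0 (if all functors, natural transformations and comonads are identities, its boundaries
  are alternately 0 and the identity, starting with 0 from degree 1 to degree 0). Contractibility of
  a bar-type complex therefore refers to its augmentation by \<open>N\<epsilon>M\<close>, which is the value of the
  boundary formula in degree 0, where the only face is \<open>d\<^sub>0 = N\<epsilon>M\<close>. Contractibility of
  the augmented complex says precisely that \<open>N\<epsilon>M\<close> is a chain homotopy equivalence from the
  unaugmented complex to \<open>NM\<close> concentrated in degree 0.\<close>

definition augment ::
  "('oy, 'my, 'oz, 'mz) fnctr \<Rightarrow> ('oy \<Rightarrow> 'mz) \<Rightarrow> ('oy, 'my, 'oz, 'mz) cplx
    \<Rightarrow> ('oy, 'my, 'oz, 'mz) cplx" where
  "augment A \<epsilon> X = \<lparr>
    chain = \<lambda>n. (case n of 0 \<Rightarrow> A | Suc k \<Rightarrow> chain X k),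
    bdry = \<lambda>n. (case n of 0 \<Rightarrow> \<epsilon> | Suc k \<Rightarrow> bdry X k)\<rparr>"

end

theory Submission
  imports Defs
begin

text \<open>An augmented simplicial functor with an extra degeneracy \<open>h\<close>, i.e. \<open>d\<^sub>0h = id\<close> and
  \<open>d\<^sub>i\<^sub>+\<^sub>1h = hd\<^sub>i\<close>, has contractible associated complex. If \<open>\<nabla> : N \<rightarrow> NT\<close> is a \<open>T\<close>-opcoalgebra
  structure, then \<open>\<nabla>T\<^sup>nM\<close> is an extra degeneracy for \<open>C\<^sub>T(N,M)\<close>, while
  \<open>NS\<^sup>nM \<rightarrow> NTS\<^sup>nM \<rightarrow> NS\<^sup>nTM \<rightarrow> NS\<^sup>n\<^sup>+\<^sup>1M\<close>, built from \<open>\<nabla>\<close>, the iterated \<open>\<chi>\<close> and \<open>\<rho>\<close>, is one for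
  \<open>C\<^sup>o\<^sup>p\<^sub>S(N,M)\<close>. Dually, if \<open>\<nabla> : M \<rightarrow> SM\<close> is an \<open>S\<close>-coalgebra structure, one takes \<open>NS\<^sup>n\<nabla>\<close> for
  \<open>C\<^sup>o\<^sup>p\<^sub>S(N,M)\<close> and \<open>NT\<^sup>nM \<rightarrow> NT\<^sup>nSM \<rightarrow> NST\<^sup>nM \<rightarrow> NT\<^sup>n\<^sup>+\<^sup>1M\<close> for \<open>C\<^sub>T(N,M)\<close>.
  In these formulas degree \<open>n\<close> is that of the
  augmented complex, one more than the simplicial degree.\<close>

section \<open>Alternating sums and extra degeneracies\<close>

text \<open>The sum occurring in \<open>associated_complex\<close>, for an arbitrary group. The
  index \<open>n\<close> is included, so there are \<open>n + 1\<close> terms; this is the number of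
  faces in the boundary of the augmented complex from degree \<open>n + 1\<close> to degree
  \<open>n\<close>.\<close>

definition alt_sum :: "('a, 'b) monoid_scheme \<Rightarrow> (nat \<Rightarrow> 'a) \<Rightarrow> nat \<Rightarrow> 'a" where
  "alt_sum G f n = finprod G (\<lambda>i. f i [^]\<^bsub>G\<^esub> ((-1::int) ^ i)) {0..n}"

context comm_group
begin

lemma alt_sum_closed [intro, simp]: "(\<And>i. i \<le> n \<Longrightarrow> f i \<in> carrier G) \<Longrightarrow> alt_sum G f n \<in> carrier G"
  unfolding alt_sum_def by (rule finprod_closed) auto

lemma alt_sum_cong:
  "\<lbrakk>\<And>i. i \<le> n \<Longrightarrow> f i = g i; \<And>i. i \<le> n \<Longrightarrow> g i \<in> carrier G\<rbrakk> \<Longrightarrow> alt_sum G f n = alt_sum G g n"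
  unfolding alt_sum_def by (rule finprod_cong') auto

lemma alt_sum_0 [simp]: "f 0 \<in> carrier G \<Longrightarrow> alt_sum G f 0 = f 0"
  by (simp add: alt_sum_def)

lemma finprod_inv:
  assumes "\<And>i. i \<in> A \<Longrightarrow> f i \<in> carrier G"
  shows "inv (finprod G f A) = finprod G (\<lambda>i. inv (f i)) A"
  using assms
proof (induction A rule: infinite_finite_induct)
  case (insert x A)
  then show ?case
    by (simp add: Pi_iff inv_mult)
qed auto

text \<open>Shifting the index by one flips every sign, hence the inverse. The first term is split
  off, and not the last, because the zeroth face plays the special role for an extra degeneracy; the
  later inductions use this recursion.\<close>

lemma alt_sum_Suc:
  assumes "\<And>i. i \<le> Suc n \<Longrightarrow> f i \<in> carrier G"
  shows "alt_sum G f (Suc n) = f 0 \<otimes> inv (alt_sum G (\<lambda>i. f (Suc i)) n)"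
proof -
  let ?g = "\<lambda>i. f i [^] ((-1::int) ^ i)"
  have "alt_sum G f (Suc n) = finprod G (\<lambda>i. ?g (Suc i)) {..n} \<otimes> ?g 0"
    unfolding alt_sum_def atMost_atLeast0[symmetric]
    by (rule finprod_Suc2) (use assms in auto)
  also have "finprod G (\<lambda>i. ?g (Suc i)) {..n} = finprod G (\<lambda>i. inv (f (Suc i) [^] ((-1::int) ^ i))) {..n}"
    by (rule finprod_cong') (use assms in \<open>auto simp: int_pow_neg\<close>)
  also have "\<dots> = inv (finprod G (\<lambda>i. f (Suc i) [^] ((-1::int) ^ i)) {..n})"
    by (rule finprod_inv[symmetric]) (use assms in auto)
  also have "\<dots> = inv (alt_sum G (\<lambda>i. f (Suc i)) n)"
    by (simp add: alt_sum_def atMost_atLeast0)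
  finally show ?thesis
    using assms by (simp add: m_comm)
qed

text \<open>Additivity of the sum in its terms, stated for differences because
  \<open>alt_sum_Suc\<close> turns the inner sums of a double sum into differences.\<close>

lemma alt_sum_mult_inv:
  assumes "\<And>i. i \<le> n \<Longrightarrow> f i \<in> carrier G" and "\<And>i. i \<le> n \<Longrightarrow> g i \<in> carrier G"
  shows "alt_sum G (\<lambda>i. f i \<otimes> inv (g i)) n = alt_sum G f n \<otimes> inv (alt_sum G g n)"
  using assms
proof (induction n arbitrary: f g)
  case (Suc n)
  have "alt_sum G (\<lambda>i. f (Suc i) \<otimes> inv (g (Suc i))) n
      = alt_sum G (\<lambda>i. f (Suc i)) n \<otimes> inv (alt_sum G (\<lambda>i. g (Suc i)) n)"
    by (rule Suc.IH) (use Suc.prems in auto)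
  then show ?case
    using Suc.prems by (simp add: alt_sum_Suc inv_mult m_ac)
qed auto

text \<open>With the simplicial identities as hypothesis, this is \<open>b \<circ> b = 0\<close>; peeling off the row
  \<open>i = 0\<close> and the column \<open>j = 0\<close>, which cancel, leaves the same sum for \<open>n - 1\<close>.\<close>

lemma alt_sum_alt_sum_eq_one:
  assumes "\<And>i j. \<lbrakk>i \<le> n; j \<le> Suc n\<rbrakk> \<Longrightarrow> a i j \<in> carrier G"
    and "\<And>i j. \<lbrakk>i \<le> j; j \<le> n\<rbrakk> \<Longrightarrow> a i (Suc j) = a j i"
  shows "alt_sum G (\<lambda>i. alt_sum G (a i) (Suc n)) n = \<one>"
  using assms
proof (induction n arbitrary: a)
  case 0
  then show ?case
    by (simp add: alt_sum_Suc)
next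
  case (Suc n)
  let ?m = "Suc n"
  have "alt_sum G (\<lambda>i. alt_sum G (a i) (Suc ?m)) ?m
      = alt_sum G (\<lambda>i. a i 0 \<otimes> inv (alt_sum G (\<lambda>j. a i (Suc j)) ?m)) ?m"
    by (rule alt_sum_cong) (use Suc.prems(1) in \<open>auto simp: alt_sum_Suc intro!: alt_sum_closed\<close>)
  also have "\<dots> = alt_sum G (\<lambda>i. a i 0) ?m \<otimes> inv (alt_sum G (\<lambda>i. alt_sum G (\<lambda>j. a i (Suc j)) ?m) ?m)"
    by (rule alt_sum_mult_inv) (use Suc.prems(1) in auto)
  also have "alt_sum G (\<lambda>i. alt_sum G (\<lambda>j. a i (Suc j)) ?m) ?m
      = alt_sum G (\<lambda>j. a 0 (Suc j)) ?m
        \<otimes> inv (alt_sum G (\<lambda>i. alt_sum G (\<lambda>j. a (Suc i) (Suc j)) ?m) n)"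
    by (rule alt_sum_Suc) (use Suc.prems(1) in auto)
  also have "alt_sum G (\<lambda>i. alt_sum G (\<lambda>j. a (Suc i) (Suc j)) ?m) n = \<one>"
    by (rule Suc.IH) (use Suc.prems in auto)
  also have "alt_sum G (\<lambda>j. a 0 (Suc j)) ?m = alt_sum G (\<lambda>i. a i 0) ?m"
    by (rule alt_sum_cong) (use Suc.prems in auto)
  finally show ?case
    using Suc.prems(1) by simp
qed

lemma alt_sum_hom:
  assumes "comm_group H" "\<phi> \<in> hom G H" "\<And>i. i \<le> n \<Longrightarrow> f i \<in> carrier G"
  shows "\<phi> (alt_sum G f n) = alt_sum H (\<lambda>i. \<phi> (f i)) n"
  using assms(3)
proof (induction n arbitrary: f)
  case 0
  interpret H: comm_group H by fact
  show ?case
    using 0 hom_in_carrier[OF assms(2)] by simp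
next
  case (Suc n)
  interpret H: comm_group H by fact
  interpret group_hom G H \<phi>
    by (simp add: group_hom_def group_hom_axioms_def is_group H.is_group assms(2))
  have "\<phi> (alt_sum G (\<lambda>i. f (Suc i)) n) = alt_sum H (\<lambda>i. \<phi> (f (Suc i))) n"
    by (rule Suc.IH) (use Suc.prems in auto)
  then show ?case
    using Suc.prems by (simp add: alt_sum_Suc H.alt_sum_Suc)
qed

end

section \<open>Alternating sums of morphisms and contractibility from an extra degeneracy\<close>

lemma (in category) hom_set_Ob: "f \<in> hom_set C a b \<Longrightarrow> a \<in> Ob C \<and> b \<in> Ob C"
  using Dom_closed Cod_closed by (auto simp: hom_set_def)

context abelian_category
begin

lemma hom_group_simps [simp]:
  "carrier (hom_group C a b) = hom_set C a b"
  "x \<otimes>\<^bsub>hom_group C a b\<^esub> y = Add C x y"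
  "\<one>\<^bsub>hom_group C a b\<^esub> = Nul C a b"
  by (simp_all add: hom_group_def)

lemma Cmp_hom_left:
  "\<lbrakk>a \<in> Ob C; g \<in> hom_set C b c\<rbrakk> \<Longrightarrow> (\<lambda>f. g \<cdot> f) \<in> hom (hom_group C a b) (hom_group C a c)"
  by (auto simp: hom_def Cmp_Add_right intro: Cmp_closed)

lemma Cmp_hom_right:
  "\<lbrakk>c \<in> Ob C; f \<in> hom_set C a b\<rbrakk> \<Longrightarrow> (\<lambda>g. g \<cdot> f) \<in> hom (hom_group C b c) (hom_group C a c)"
  by (auto simp: hom_def Cmp_Add_left intro: Cmp_closed)

text \<open>Composition with a fixed morphism is a homomorphism of hom-groups, so
  \<open>alt_sum_hom\<close> applies; the next lemma does the same on the other side.\<close>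

lemma Cmp_alt_sum_left:
  assumes "g \<in> hom_set C b c" "a \<in> Ob C" "\<And>i. i \<le> n \<Longrightarrow> f i \<in> hom_set C a b"
  shows "g \<cdot> alt_sum (hom_group C a b) f n = alt_sum (hom_group C a c) (\<lambda>i. g \<cdot> f i) n"
  using comm_group.alt_sum_hom[OF hom_comm_group hom_comm_group Cmp_hom_left, of a b c g n f]
    assms hom_set_Ob by auto

lemma Cmp_alt_sum_right:
  assumes "f \<in> hom_set C a b" "c \<in> Ob C" "\<And>i. i \<le> n \<Longrightarrow> g i \<in> hom_set C b c"
  shows "alt_sum (hom_group C b c) g n \<cdot> f = alt_sum (hom_group C a c) (\<lambda>i. g i \<cdot> f) n"
  using comm_group.alt_sum_hom[OF hom_comm_group hom_comm_group Cmp_hom_right, of b c a f n g]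
    assms hom_set_Ob by auto

end

text \<open>The homotopy identity is \<open>bh = d_0 h - (d_1 h - d_2 h + ...) = id - hb\<close>.
  All indices are those of the augmented complex: \<open>d n i\<close> lowers degree
  \<open>n + 1\<close> to degree \<open>n\<close>, with i from 0 to \<open>n\<close>. The
  augmentation is thus the case \<open>n = 0\<close> and needs no separate treatment. In degree 0
  the identity reduces to \<open>d_0 h = id\<close>.\<close>

lemma contractible_complexI:
  fixes Y :: "('oy, 'my, 'y) cat_scheme" and Z :: "('oz, 'mz, 'z) abcat_scheme"
    and X :: "('oy, 'my, 'oz, 'mz) cplx"
  assumes Z: "abelian_category Z"
    and d: "\<And>n i. i \<le> n \<Longrightarrow> nat_trans Y Z (chain X (Suc n)) (chain X n) (d n i)"
    and bdry: "\<And>n y. y \<in> Ob Y \<Longrightarrow> bdry X n y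
      = alt_sum (hom_group Z (fobj (chain X (Suc n)) y) (fobj (chain X n) y)) (\<lambda>i. d n i y) n"
    and dd: "\<And>n i j y. \<lbrakk>i \<le> j; j \<le> n; y \<in> Ob Y\<rbrakk>
      \<Longrightarrow> d n i y \<cdot>\<^bsub>Z\<^esub> d (Suc n) (Suc j) y = d n j y \<cdot>\<^bsub>Z\<^esub> d (Suc n) i y"
    and h: "\<And>n. nat_trans Y Z (chain X n) (chain X (Suc n)) (h n)"
    and d0h: "\<And>n y. y \<in> Ob Y \<Longrightarrow> d n 0 y \<cdot>\<^bsub>Z\<^esub> h n y = Ide Z (fobj (chain X n) y)"
    and dh: "\<And>n i y. \<lbrakk>i \<le> n; y \<in> Ob Y\<rbrakk>
      \<Longrightarrow> d (Suc n) (Suc i) y \<cdot>\<^bsub>Z\<^esub> h (Suc n) y = h n y \<cdot>\<^bsub>Z\<^esub> d n i y"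
  shows "contractible_complex Y Z X"
proof -
  interpret Z: abelian_category Z by fact
  interpret h: nat_trans Y Z "chain X n" "chain X (Suc n)" "h n" for n by fact
  let ?F = "\<lambda>n y. fobj (chain X n) y"
  have F [simp]: "?F n y \<in> Ob Z" if "y \<in> Ob Y" for n y
    using that by (rule h.F.fobj_closed)
  have d_hom [simp]: "d n i y \<in> hom_set Z (?F (Suc n) y) (?F n y)" if "i \<le> n" "y \<in> Ob Y" for n i y
    using nat_trans.component[OF d] that by blast
  have h_hom [simp]: "h n y \<in> hom_set Z (?F n y) (?F (Suc n) y)" if "y \<in> Ob Y" for n y
    using h.component that by blast
  have grp: "comm_group (hom_group Z (?F m y) (?F n y'))" if "y \<in> Ob Y" "y' \<in> Ob Y" for m n y y'
    using that by (simp add: Z.hom_comm_group)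
  have b_hom: "bdry X n y \<in> hom_set Z (?F (Suc n) y) (?F n y)" if "y \<in> Ob Y" for n y
    using comm_group.alt_sum_closed[OF grp[OF that that], of n "\<lambda>i. d n i y" "Suc n" n] that
    by (simp add: bdry)
  have b_nt: "nat_trans Y Z (chain X (Suc n)) (chain X n) (bdry X n)" for n
  proof
    fix f a b assume f: "f \<in> hom_set Y a b"
    then have ab: "a \<in> Ob Y" "b \<in> Ob Y"
      using h.F.A.Dom_closed h.F.A.Cod_closed by (auto simp: hom_set_def)
    have fF: "farr (chain X m) f \<in> hom_set Z (?F m a) (?F m b)" for m
      using f by (rule h.F.farr_closed)
    have "bdry X n b \<cdot>\<^bsub>Z\<^esub> farr (chain X (Suc n)) f
        = alt_sum (hom_group Z (?F (Suc n) a) (?F n b)) (\<lambda>i. d n i b \<cdot>\<^bsub>Z\<^esub> farr (chain X (Suc n)) f) n"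
      using ab by (simp add: bdry Z.Cmp_alt_sum_right[OF fF])
    also have "\<dots> = alt_sum (hom_group Z (?F (Suc n) a) (?F n b)) (\<lambda>i. farr (chain X n) f \<cdot>\<^bsub>Z\<^esub> d n i a) n"
      using ab f by (intro comm_group.alt_sum_cong[OF grp])
        (auto simp: nat_trans.naturality[OF d] intro!: Z.Cmp_closed[OF _ fF])
    also have "\<dots> = farr (chain X n) f \<cdot>\<^bsub>Z\<^esub> bdry X n a"
      using ab by (simp add: bdry Z.Cmp_alt_sum_left[OF fF])
    finally show "bdry X n b \<cdot>\<^bsub>Z\<^esub> farr (chain X (Suc n)) f = farr (chain X n) f \<cdot>\<^bsub>Z\<^esub> bdry X n a" .
  qed (use b_hom in simp)
  have bb: "bdry X n y \<cdot>\<^bsub>Z\<^esub> bdry X (Suc n) y = Nul Z (?F (Suc (Suc n)) y) (?F n y)"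
    if y: "y \<in> Ob Y" for n y
  proof -
    let ?H = "hom_group Z (?F (Suc (Suc n)) y) (?F n y)"
    interpret H: comm_group ?H
      using y by (rule grp) fact
    have dd_hom: "d n i y \<cdot>\<^bsub>Z\<^esub> d (Suc n) j y \<in> hom_set Z (?F (Suc (Suc n)) y) (?F n y)"
      if "i \<le> n" "j \<le> Suc n" for i j
      using that y by (intro Z.Cmp_closed[OF d_hom d_hom])
    have "bdry X n y \<cdot>\<^bsub>Z\<^esub> bdry X (Suc n) y = alt_sum ?H (\<lambda>i. d n i y \<cdot>\<^bsub>Z\<^esub> bdry X (Suc n) y) n"
      using y Z.Cmp_alt_sum_right[OF b_hom[OF y, of "Suc n"], of "?F n y" n "\<lambda>i. d n i y"]
      by (simp add: bdry[OF y, of n])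
    also have "\<dots> = alt_sum ?H (\<lambda>i. alt_sum ?H (\<lambda>j. d n i y \<cdot>\<^bsub>Z\<^esub> d (Suc n) j y) (Suc n)) n"
    proof (rule H.alt_sum_cong)
      fix i assume i: "i \<le> n"
      show "d n i y \<cdot>\<^bsub>Z\<^esub> bdry X (Suc n) y = alt_sum ?H (\<lambda>j. d n i y \<cdot>\<^bsub>Z\<^esub> d (Suc n) j y) (Suc n)"
        using y by (simp add: bdry Z.Cmp_alt_sum_left[OF d_hom[OF i y]])
      show "alt_sum ?H (\<lambda>j. d n i y \<cdot>\<^bsub>Z\<^esub> d (Suc n) j y) (Suc n) \<in> carrier ?H"
        using i by (intro H.alt_sum_closed) (simp add: dd_hom)
    qed
    \<comment> \<open>The double sum has entries \<open>d_i d_j\<close>, and \<open>dd\<close> is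
      the symmetry of this array under which the sum cancels.\<close>
    also have "\<dots> = \<one>\<^bsub>?H\<^esub>"
      using dd_hom dd y by (intro H.alt_sum_alt_sum_eq_one) auto
    finally show ?thesis by simp
  qed
  have b0h: "bdry X 0 y \<cdot>\<^bsub>Z\<^esub> h 0 y = Ide Z (?F 0 y)" if "y \<in> Ob Y" for y
    using that by (simp add: bdry comm_group.alt_sum_0[OF grp] d0h)
  have bh: "Add Z (bdry X (Suc n) y \<cdot>\<^bsub>Z\<^esub> h (Suc n) y) (h n y \<cdot>\<^bsub>Z\<^esub> bdry X n y) = Ide Z (?F (Suc n) y)"
    if y: "y \<in> Ob Y" for n y
  proof -
    let ?H = "hom_group Z (?F (Suc n) y) (?F (Suc n) y)"
    interpret H: comm_group ?H
      using y by (rule grp) fact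
    let ?s = "alt_sum ?H (\<lambda>i. h n y \<cdot>\<^bsub>Z\<^esub> d n i y) n"
    have hd_hom: "h n y \<cdot>\<^bsub>Z\<^esub> d n i y \<in> carrier ?H" if "i \<le> n" for i
      using that y Z.Cmp_closed[OF d_hom h_hom] by simp
    have dh_hom: "d (Suc n) i y \<cdot>\<^bsub>Z\<^esub> h (Suc n) y \<in> carrier ?H" if "i \<le> Suc n" for i
      using that y Z.Cmp_closed[OF h_hom d_hom] by simp
    have "bdry X (Suc n) y \<cdot>\<^bsub>Z\<^esub> h (Suc n) y = alt_sum ?H (\<lambda>i. d (Suc n) i y \<cdot>\<^bsub>Z\<^esub> h (Suc n) y) (Suc n)"
      using y by (simp add: bdry Z.Cmp_alt_sum_right[OF h_hom])
    \<comment> \<open>The term with index 0 is the identity by \<open>d0h\<close>. The others become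
      \<open>h d_i\<close> by \<open>dh\<close>, with opposite signs because of the index
      shift.\<close>
    also have "\<dots> = Ide Z (?F (Suc n) y) \<otimes>\<^bsub>?H\<^esub> inv\<^bsub>?H\<^esub> ?s"
      using y by (subst H.alt_sum_Suc[OF dh_hom])
        (auto simp: d0h dh cong: H.alt_sum_cong[OF _ hd_hom])
    finally have 1: "bdry X (Suc n) y \<cdot>\<^bsub>Z\<^esub> h (Suc n) y = Ide Z (?F (Suc n) y) \<otimes>\<^bsub>?H\<^esub> inv\<^bsub>?H\<^esub> ?s" .
    have 2: "h n y \<cdot>\<^bsub>Z\<^esub> bdry X n y = ?s"
      using y by (simp add: bdry Z.Cmp_alt_sum_left[OF h_hom])
    have s: "?s \<in> carrier ?H" and id: "Ide Z (?F (Suc n) y) \<in> carrier ?H"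
      using hd_hom y by (auto intro: H.alt_sum_closed Z.Ide_closed simp del: Z.hom_group_simps) (simp add: Z.Ide_closed)
    have "(Ide Z (?F (Suc n) y) \<otimes>\<^bsub>?H\<^esub> inv\<^bsub>?H\<^esub> ?s) \<otimes>\<^bsub>?H\<^esub> ?s = Ide Z (?F (Suc n) y)"
      using s id by (simp add: H.m_assoc del: Z.hom_group_simps)
    then show ?thesis
      unfolding 1 2 by simp
  qed
  have "chain_complex Y Z X"
    using Z bb b_nt h.F.is_functor_axioms by (simp add: chain_complex_def chain_complex_axioms_def)
  then show ?thesis
    unfolding contractible_complex_def using h b0h bh by blast
qed

section \<open>Functors and natural transformations\<close>

lemma fnctr_simps [simp]:
  "fobj (G \<odot> F) a = fobj G (fobj F a)" "farr (G \<odot> F) f = farr G (farr F f)"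
  "fobj fid a = a" "farr fid f = f"
  by (simp_all add: fcomp_def fid_def)

lemma fcomp_assoc: "(H \<odot> G) \<odot> F = H \<odot> G \<odot> F"
  by (simp add: fcomp_def)

lemma fcomp_fid [simp]: "F \<odot> fid = F" "fid \<odot> F = F"
  by (simp_all add: fcomp_def fid_def)

lemma fpow_add: "fpow T (m + n) = fpow T m \<odot> fpow T n"
  by (induction m) (simp_all add: fcomp_assoc)

lemma fpow_Suc_right: "fpow T (Suc n) = fpow T n \<odot> T"
  using fpow_add[of T n 1] by simp

lemma fobj_fpow_comm: "fobj (fpow T n) (fobj T a) = fobj T (fobj (fpow T n) a)"
  using fpow_Suc_right[of T n] fnctr_simps(1) by (metis fpow.simps(2))

lemma (in category) is_functor_fid: "is_functor C C fid"
  by unfold_locales auto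

lemma is_functor_fcomp:
  assumes "is_functor B C G" "is_functor A B F"
  shows "is_functor A C (G \<odot> F)"
proof -
  interpret G: is_functor B C G by fact
  interpret F: is_functor A B F by fact
  show ?thesis
    by unfold_locales
      (simp_all add: F.farr_Ide G.farr_Ide[OF F.fobj_closed] F.farr_Cmp
        G.farr_Cmp[OF F.farr_closed F.farr_closed] F.fobj_closed G.fobj_closed F.farr_closed G.farr_closed)
qed

lemma is_functor_fpow:
  assumes "is_functor B B T"
  shows "is_functor B B (fpow T n)"
proof -
  interpret is_functor B B T by fact
  show ?thesis
    by (induction n) (auto intro: A.is_functor_fid is_functor_fcomp assms)
qed

lemma nat_trans_id:
  assumes "is_functor A B F"
  shows "nat_trans A B F F (\<lambda>a. Ide B (fobj F a))"
proof -
  interpret is_functor A B F by fact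
  show ?thesis
    by unfold_locales
      (simp_all add: fobj_closed B.Ide_closed B.Cmp_Ide_left[OF farr_closed] B.Cmp_Ide_right[OF farr_closed])
qed

lemma nat_trans_vcomp:
  assumes "nat_trans A B G H \<beta>" "nat_trans A B F G \<alpha>"
  shows "nat_trans A B F H (\<lambda>a. \<beta> a \<cdot>\<^bsub>B\<^esub> \<alpha> a)"
proof -
  interpret b: nat_trans A B G H \<beta> by fact
  interpret a: nat_trans A B F G \<alpha> by fact
  show ?thesis
  proof
    fix a assume a: "a \<in> Ob A"
    show "\<beta> a \<cdot>\<^bsub>B\<^esub> \<alpha> a \<in> hom_set B (fobj F a) (fobj H a)"
      by (rule b.F.B.Cmp_closed[OF a.component[OF a] b.component[OF a]])
  next
    fix f x y assume f: "f \<in> hom_set A x y"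
    then have xy: "x \<in> Ob A" "y \<in> Ob A"
      using b.F.A.hom_set_Ob by auto
    note ax = a.component[OF xy(1)] and ay = a.component[OF xy(2)]
    note bx = b.component[OF xy(1)] and b_y = b.component[OF xy(2)]
    note assoc = b.F.B.Cmp_assoc
    have "(\<beta> y \<cdot>\<^bsub>B\<^esub> \<alpha> y) \<cdot>\<^bsub>B\<^esub> farr F f = \<beta> y \<cdot>\<^bsub>B\<^esub> farr G f \<cdot>\<^bsub>B\<^esub> \<alpha> x"
      by (simp add: assoc[OF a.F.farr_closed[OF f] ay b_y] a.naturality[OF f])
    also have "\<dots> = (farr H f \<cdot>\<^bsub>B\<^esub> \<beta> x) \<cdot>\<^bsub>B\<^esub> \<alpha> x"
      by (simp add: assoc[OF ax b.F.farr_closed[OF f] b_y, symmetric] b.naturality[OF f])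
    also have "\<dots> = farr H f \<cdot>\<^bsub>B\<^esub> \<beta> x \<cdot>\<^bsub>B\<^esub> \<alpha> x"
      by (rule assoc[OF ax bx b.G.farr_closed[OF f]])
    finally show "(\<beta> y \<cdot>\<^bsub>B\<^esub> \<alpha> y) \<cdot>\<^bsub>B\<^esub> farr F f = farr H f \<cdot>\<^bsub>B\<^esub> \<beta> x \<cdot>\<^bsub>B\<^esub> \<alpha> x" .
  qed
qed

lemma nat_trans_whisker_left:
  assumes "is_functor B C K" "nat_trans A B F G \<alpha>"
  shows "nat_trans A C (K \<odot> F) (K \<odot> G) (\<lambda>a. farr K (\<alpha> a))"
proof -
  interpret K: is_functor B C K by fact
  interpret a: nat_trans A B F G \<alpha> by fact
  show ?thesis
  proof (rule nat_trans.intro[OF _ _ nat_trans_axioms.intro])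
    fix f x y assume f: "f \<in> hom_set A x y"
    then have xy: "x \<in> Ob A" "y \<in> Ob A"
      using a.F.A.hom_set_Ob by auto
    show "farr K (\<alpha> y) \<cdot>\<^bsub>C\<^esub> farr (K \<odot> F) f = farr (K \<odot> G) f \<cdot>\<^bsub>C\<^esub> farr K (\<alpha> x)"
      using xy by (simp add: K.farr_Cmp[OF a.F.farr_closed[OF f] a.component, symmetric]
        K.farr_Cmp[OF a.component a.G.farr_closed[OF f], symmetric] a.naturality[OF f])
  qed (use a.component in \<open>auto intro: is_functor_fcomp assms a.F.is_functor_axioms
      a.G.is_functor_axioms K.farr_closed\<close>)
qed

lemma nat_trans_whisker_right:
  assumes "nat_trans A B F G \<alpha>" "is_functor D A K"
  shows "nat_trans D B (F \<odot> K) (G \<odot> K) (\<lambda>a. \<alpha> (fobj K a))"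
proof -
  interpret K: is_functor D A K by fact
  interpret a: nat_trans A B F G \<alpha> by fact
  show ?thesis
    by (rule nat_trans.intro[OF _ _ nat_trans_axioms.intro])
      (use a.component K.fobj_closed a.naturality[OF K.farr_closed] in
        \<open>auto intro: is_functor_fcomp assms a.F.is_functor_axioms a.G.is_functor_axioms\<close>)
qed

section \<open>Faces and iterated distributive laws\<close>

text \<open>The component at \<open>b\<close> of \<open>T\<^sup>i\<epsilon>T\<^sup>n\<^sup>-\<^sup>i : T\<^sup>n\<^sup>+\<^sup>1 \<rightarrow> T\<^sup>n\<close>.\<close>

definition cface :: "('o, 'm) cmnd \<Rightarrow> nat \<Rightarrow> nat \<Rightarrow> 'o \<Rightarrow> 'm" where
  "cface T n i b = farr (fpow (Fun T) i) (counit T (fobj (fpow (Fun T) (n - i)) b))"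

lemma cface_0: "cface T n 0 b = counit T (fobj (fpow (Fun T) n) b)"
  by (simp add: cface_def)

lemma cface_Suc_Suc: "cface T (Suc n) (Suc i) b = farr (Fun T) (cface T n i b)"
  by (simp add: cface_def)

lemma cface_diag: "cface T n n b = farr (fpow (Fun T) n) (counit T b)"
  by (simp add: cface_def)

text \<open>The innermost copy of \<open>T\<close> is moved into the argument. The assumption
  guarantees that the counit is not applied to that copy. Homotopies acting at the right-hand end
  commute with faces in this form.\<close>

lemma cface_Suc_left: "i \<le> n \<Longrightarrow> cface T (Suc n) i b = cface T n i (fobj (Fun T) b)"
  by (simp add: cface_def Suc_diff_le fobj_fpow_comm)

section \<open>Simplicial identities for the faces of a comonad\<close>

context comonad
begin

lemma Fun_functor: "is_functor B B (Fun T)"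
  by (rule comu.F.is_functor_axioms)

lemma pow_functor: "is_functor B B (fpow (Fun T) n)"
  by (rule is_functor_fpow) (rule Fun_functor)

lemma pow_Ob [simp]: "b \<in> Ob B \<Longrightarrow> fobj (fpow (Fun T) n) b \<in> Ob B"
  by (rule is_functor.fobj_closed[OF pow_functor])

lemma cface_nat_trans:
  assumes "i \<le> n"
  shows "nat_trans B B (fpow (Fun T) (Suc n)) (fpow (Fun T) n) (cface T n i)"
proof -
  \<comment> \<open>Here \<open>i \<le> n\<close> matters: with truncated subtraction the exponents
    add up to \<open>n + 1\<close> and \<open>n\<close> only under this assumption.\<close>
  have *: "fpow (Fun T) i \<odot> Fun T \<odot> fpow (Fun T) (n - i) = fpow (Fun T) (Suc n)"
    "fpow (Fun T) i \<odot> fpow (Fun T) (n - i) = fpow (Fun T) n"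
    using assms fpow_add[of "Fun T" i "Suc (n - i)"] fpow_add[of "Fun T" i "n - i"]
    by (simp_all flip: fcomp_assoc)
  show ?thesis
    using nat_trans_whisker_left[OF pow_functor nat_trans_whisker_right[OF coun.nat_trans_axioms pow_functor],
        of i "n - i"]
    unfolding cface_def[abs_def] by (simp only: * fcomp_fid)
qed

lemmas cface_hom = nat_trans.component[OF cface_nat_trans]

text \<open>For \<open>i = 0\<close> this is naturality of the counit at the morphism
  \<open>cface T n j b\<close>. The general case follows by applying \<open>T\<close>, since
  \<open>cface_Suc_Suc\<close> lowers all face indices by one.\<close>

lemma cface_cface:
  assumes "i \<le> j" "j \<le> n" "b \<in> Ob B"
  shows "cface T n i b \<cdot>\<^bsub>B\<^esub> cface T (Suc n) (Suc j) b = cface T n j b \<cdot>\<^bsub>B\<^esub> cface T (Suc n) i b"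
  using assms
proof (induction i arbitrary: j n)
  case 0
  then show ?case
    using coun.naturality[OF cface_hom[OF 0(2,3)]] by (simp add: cface_0 cface_Suc_Suc)
next
  case (Suc i)
  then obtain j' n' where [simp]: "j = Suc j'" "n = Suc n'" and le: "i \<le> j'" "j' \<le> n'"
    by (metis Suc_le_D Suc_le_mono)
  from le have "i \<le> n'" by simp
  note hom = cface_hom[OF _ Suc.prems(3)]
  have "cface T n (Suc i) b \<cdot>\<^bsub>B\<^esub> cface T (Suc n) (Suc j) b
      = farr (Fun T) (cface T n' i b \<cdot>\<^bsub>B\<^esub> cface T (Suc n') (Suc j') b)"
    unfolding \<open>j = _\<close> \<open>n = _\<close> cface_Suc_Suc[of T n' i] cface_Suc_Suc[of T "Suc n'" "Suc j'"]
    by (rule comu.F.farr_Cmp[symmetric, OF hom hom]) (use le in auto)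
  also have "\<dots> = farr (Fun T) (cface T n' j' b \<cdot>\<^bsub>B\<^esub> cface T (Suc n') i b)"
    by (simp only: Suc.IH[OF le Suc.prems(3)])
  also have "\<dots> = cface T n j b \<cdot>\<^bsub>B\<^esub> cface T (Suc n) (Suc i) b"
    unfolding \<open>j = _\<close> \<open>n = _\<close> cface_Suc_Suc[of T n' j'] cface_Suc_Suc[of T "Suc n'" i]
    by (rule comu.F.farr_Cmp[OF hom hom]) (use le in auto)
  finally show ?case .
qed

end


section \<open>Iterated distributive laws and their compatibility with counits and faces\<close>

text \<open>The iterates \<open>TS\<^sup>n \<rightarrow> S\<^sup>nT\<close> and \<open>T\<^sup>nS \<rightarrow> ST\<^sup>n\<close> of a distributive law.\<close>

primrec swap_right :: "('o, 'm, 'x) cat_scheme \<Rightarrow> ('o, 'm) cmnd \<Rightarrow> ('o, 'm) cmnd \<Rightarrow> ('o \<Rightarrow> 'm)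
    \<Rightarrow> nat \<Rightarrow> 'o \<Rightarrow> 'm" where
  "swap_right B T S \<chi> 0 = (\<lambda>b. Ide B (fobj (Fun T) b))"
| "swap_right B T S \<chi> (Suc n) =
    (\<lambda>b. farr (Fun S) (swap_right B T S \<chi> n b) \<cdot>\<^bsub>B\<^esub> \<chi> (fobj (fpow (Fun S) n) b))"

primrec swap_left :: "('o, 'm, 'x) cat_scheme \<Rightarrow> ('o, 'm) cmnd \<Rightarrow> ('o, 'm) cmnd \<Rightarrow> ('o \<Rightarrow> 'm)
    \<Rightarrow> nat \<Rightarrow> 'o \<Rightarrow> 'm" where
  "swap_left B T S \<chi> 0 = (\<lambda>b. Ide B (fobj (Fun S) b))"
| "swap_left B T S \<chi> (Suc n) =
    (\<lambda>b. \<chi> (fobj (fpow (Fun T) n) b) \<cdot>\<^bsub>B\<^esub> farr (Fun T) (swap_left B T S \<chi> n b))"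

context distributive_law
begin

abbreviation "swr \<equiv> swap_right B T S \<chi>"
abbreviation "swl \<equiv> swap_left B T S \<chi>"

lemma swap_right_nat_trans:
  "nat_trans B B (Fun T \<odot> fpow (Fun S) n) (fpow (Fun S) n \<odot> Fun T) (swr n)"
proof (induction n)
  case 0
  show ?case
    using nat_trans_id[OF T.Fun_functor] by simp
next
  case (Suc n)
  show ?case
    using nat_trans_vcomp[OF nat_trans_whisker_left[OF S.Fun_functor Suc]
        nat_trans_whisker_right[OF chi.nat_trans_axioms S.pow_functor, of n, simplified fcomp_assoc]]
    by (simp add: fcomp_assoc)
qed

lemma swap_left_nat_trans:
  "nat_trans B B (fpow (Fun T) n \<odot> Fun S) (Fun S \<odot> fpow (Fun T) n) (swl n)"
proof (induction n)
  case 0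
  show ?case
    using nat_trans_id[OF S.Fun_functor] by simp
next
  case (Suc n)
  show ?case
    using nat_trans_vcomp[OF nat_trans_whisker_right[OF chi.nat_trans_axioms T.pow_functor, of n,
          simplified fcomp_assoc] nat_trans_whisker_left[OF T.Fun_functor Suc]]
    by (simp add: fcomp_assoc)
qed

lemma swap_right_hom:
  "b \<in> Ob B \<Longrightarrow> swr n b
    \<in> hom_set B (fobj (Fun T) (fobj (fpow (Fun S) n) b)) (fobj (fpow (Fun S) n) (fobj (Fun T) b))"
  using nat_trans.component[OF swap_right_nat_trans] by simp

lemma swap_left_hom:
  "b \<in> Ob B \<Longrightarrow> swl n b
    \<in> hom_set B (fobj (fpow (Fun T) n) (fobj (Fun S) b)) (fobj (Fun S) (fobj (fpow (Fun T) n) b))"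
  using nat_trans.component[OF swap_left_nat_trans] by simp

lemma T_Ob: "b \<in> Ob B \<Longrightarrow> fobj (Fun T) b \<in> Ob B" and S_Ob: "b \<in> Ob B \<Longrightarrow> fobj (Fun S) b \<in> Ob B"
  using T.comu.F.fobj_closed S.comu.F.fobj_closed by auto

lemma chi_hom: "b \<in> Ob B \<Longrightarrow>
    \<chi> b \<in> hom_set B (fobj (Fun T) (fobj (Fun S) b)) (fobj (Fun S) (fobj (Fun T) b))"
  using chi.component by simp

lemma counit_T_hom: "b \<in> Ob B \<Longrightarrow> counit T b \<in> hom_set B (fobj (Fun T) b) b"
  using T.coun.component by simp

lemma counit_S_hom: "b \<in> Ob B \<Longrightarrow> counit S b \<in> hom_set B (fobj (Fun S) b) b"
  using S.coun.component by simp

lemmas B_assoc = T.comu.F.A.Cmp_assoc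

text \<open>Iterates the axiom \<open>counit_T\<close>: each \<chi> moves the counit of
  \<open>T\<close> from the inside of one copy of \<open>S\<close> to its outside.\<close>

lemma counit_swap_right:
  assumes b: "b \<in> Ob B"
  shows "farr (fpow (Fun S) n) (counit T b) \<cdot>\<^bsub>B\<^esub> swr n b = counit T (fobj (fpow (Fun S) n) b)"
proof (induction n)
  case 0
  show ?case
    using T.comu.F.A.Cmp_Ide_right[OF counit_T_hom[OF b]] by simp
next
  case (Suc n)
  let ?b = "fobj (fpow (Fun S) n) b" and ?e = "farr (fpow (Fun S) n) (counit T b)"
  have e: "?e \<in> hom_set B (fobj (fpow (Fun S) n) (fobj (Fun T) b)) ?b"
    by (rule is_functor.farr_closed[OF S.pow_functor counit_T_hom[OF b]])
  have "farr (fpow (Fun S) (Suc n)) (counit T b) \<cdot>\<^bsub>B\<^esub> swr (Suc n) b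
      = (farr (Fun S) ?e \<cdot>\<^bsub>B\<^esub> farr (Fun S) (swr n b)) \<cdot>\<^bsub>B\<^esub> \<chi> ?b"
    using b by (simp add: B_assoc[OF chi_hom S.comu.F.farr_closed[OF swap_right_hom]
          S.comu.F.farr_closed[OF e]])
  also have "\<dots> = farr (Fun S) (counit T ?b) \<cdot>\<^bsub>B\<^esub> \<chi> ?b"
    by (simp only: S.comu.F.farr_Cmp[OF swap_right_hom[OF b] e, symmetric] Suc)
  also have "\<dots> = counit T (fobj (fpow (Fun S) (Suc n)) b)"
    using b by (simp add: counit_T)
  finally show ?case .
qed

text \<open>Iterates the axiom \<open>counit_S\<close>, which moves the counit of \<open>S\<close>
  from the outside of one copy of \<open>T\<close> to its inside.\<close>

lemma counit_swap_left:
  assumes b: "b \<in> Ob B"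
  shows "counit S (fobj (fpow (Fun T) n) b) \<cdot>\<^bsub>B\<^esub> swl n b = farr (fpow (Fun T) n) (counit S b)"
proof (induction n)
  case 0
  show ?case
    using T.comu.F.A.Cmp_Ide_right[OF counit_S_hom[OF b]] by simp
next
  case (Suc n)
  let ?b = "fobj (fpow (Fun T) n) b"
  have bB: "?b \<in> Ob B" using b by simp
  have "counit S (fobj (fpow (Fun T) (Suc n)) b) \<cdot>\<^bsub>B\<^esub> swl (Suc n) b
      = (counit S (fobj (Fun T) ?b) \<cdot>\<^bsub>B\<^esub> \<chi> ?b) \<cdot>\<^bsub>B\<^esub> farr (Fun T) (swl n b)"
    using b by (simp add: B_assoc[OF T.comu.F.farr_closed[OF swap_left_hom] chi_hom
          counit_S_hom[OF T_Ob]])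
  also have "\<dots> = farr (Fun T) (counit S ?b \<cdot>\<^bsub>B\<^esub> swl n b)"
    by (simp only: counit_S[OF bB] T.comu.F.farr_Cmp[OF swap_left_hom[OF b] counit_S_hom[OF bB]])
  finally show ?case
    by (simp add: Suc)
qed

text \<open>Moving \<open>T\<close> past a string of copies of \<open>S\<close> commutes with
  deleting one of them. If the outermost copy is deleted, naturality of the counit of
  \<open>S\<close> brings that counit next to \<chi>, and \<open>counit_S\<close> absorbs \<chi>.
  Otherwise the outermost copy is peeled off by induction.\<close>

lemma cface_swap_right:
  assumes b: "b \<in> Ob B" and "i \<le> n"
  shows "cface S n i (fobj (Fun T) b) \<cdot>\<^bsub>B\<^esub> swr (Suc n) b = swr n b \<cdot>\<^bsub>B\<^esub> farr (Fun T) (cface S n i b)"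
  using \<open>i \<le> n\<close>
proof (induction i arbitrary: n)
  case 0
  let ?b = "fobj (fpow (Fun S) n) b"
  have bB: "?b \<in> Ob B" using b by simp
  have "cface S n 0 (fobj (Fun T) b) \<cdot>\<^bsub>B\<^esub> swr (Suc n) b
      = (counit S (fobj (fpow (Fun S) n) (fobj (Fun T) b)) \<cdot>\<^bsub>B\<^esub> farr (Fun S) (swr n b)) \<cdot>\<^bsub>B\<^esub> \<chi> ?b"
    using b by (simp add: cface_0 T_Ob B_assoc[OF chi_hom S.comu.F.farr_closed[OF swap_right_hom] counit_S_hom])
  also have "\<dots> = swr n b \<cdot>\<^bsub>B\<^esub> (counit S (fobj (Fun T) ?b) \<cdot>\<^bsub>B\<^esub> \<chi> ?b)"
    using S.coun.naturality[OF swap_right_hom[OF b, of n]] b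
    by (simp add: T_Ob B_assoc[OF chi_hom counit_S_hom swap_right_hom])
  also have "\<dots> = swr n b \<cdot>\<^bsub>B\<^esub> farr (Fun T) (cface S n 0 b)"
    by (simp add: counit_S[OF bB] cface_0)
  finally show ?case .
next
  case (Suc i)
  then obtain m where [simp]: "n = Suc m" and im: "i \<le> m"
    by (metis Suc_le_D Suc_le_mono)
  let ?b = "fobj (fpow (Fun S) (Suc m)) b" and ?b' = "fobj (fpow (Fun S) m) b"
  have bB: "?b \<in> Ob B" "?b' \<in> Ob B"
    using b S.pow_Ob by blast+
  note e = S.cface_hom[OF im b] and eT = S.cface_hom[OF im T_Ob[OF b]]
  note w = swap_right_hom[OF b, of "Suc m"] and w' = swap_right_hom[OF b, of m]
  have "cface S (Suc m) (Suc i) (fobj (Fun T) b) \<cdot>\<^bsub>B\<^esub> swr (Suc (Suc m)) b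
      = (farr (Fun S) (cface S m i (fobj (Fun T) b)) \<cdot>\<^bsub>B\<^esub> farr (Fun S) (swr (Suc m) b)) \<cdot>\<^bsub>B\<^esub> \<chi> ?b"
    unfolding cface_Suc_Suc swap_right.simps(2)[of _ _ _ _ "Suc m"]
    by (rule B_assoc[symmetric, OF chi_hom[OF bB(1)] S.comu.F.farr_closed[OF w] S.comu.F.farr_closed[OF eT]])
  also have "\<dots> = farr (Fun S) (swr m b \<cdot>\<^bsub>B\<^esub> farr (Fun T) (cface S m i b)) \<cdot>\<^bsub>B\<^esub> \<chi> ?b"
    by (simp only: S.comu.F.farr_Cmp[OF w eT, symmetric] Suc.IH[OF im])
  also have "\<dots> = farr (Fun S) (swr m b) \<cdot>\<^bsub>B\<^esub> (farr (Fun S) (farr (Fun T) (cface S m i b)) \<cdot>\<^bsub>B\<^esub> \<chi> ?b)"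
    unfolding S.comu.F.farr_Cmp[OF T.comu.F.farr_closed[OF e] w']
    by (rule B_assoc[OF chi_hom[OF bB(1)] S.comu.F.farr_closed[OF T.comu.F.farr_closed[OF e]] S.comu.F.farr_closed[OF w']])
  \<comment> \<open>The outermost \<chi> is not affected by the deletion, so naturality lets the
    inner face pass through it.\<close>
  also have "\<dots> = farr (Fun S) (swr m b) \<cdot>\<^bsub>B\<^esub> (\<chi> ?b' \<cdot>\<^bsub>B\<^esub> farr (Fun T) (farr (Fun S) (cface S m i b)))"
    using chi.naturality[OF e] by simp
  also have "\<dots> = swr (Suc m) b \<cdot>\<^bsub>B\<^esub> farr (Fun T) (cface S (Suc m) (Suc i) b)"
    unfolding cface_Suc_Suc swap_right.simps(2)
    by (rule B_assoc[symmetric, OF T.comu.F.farr_closed[OF S.comu.F.farr_closed[OF e]] _ S.comu.F.farr_closed[OF w']])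
      (rule chi_hom[OF bB(2)])
  finally show ?case by simp
qed

text \<open>The mirror image: for \<open>i = 0\<close> first \<open>counit_T\<close> absorbs the
  outermost \<chi>, then naturality of the counit of \<open>T\<close> applies. In the induction step
  naturality of \<chi> comes first as well, because \<open>swap_left\<close> has its new \<chi> on
  the left of the composite.\<close>

lemma cface_swap_left:
  assumes b: "b \<in> Ob B" and "i \<le> n"
  shows "farr (Fun S) (cface T n i b) \<cdot>\<^bsub>B\<^esub> swl (Suc n) b = swl n b \<cdot>\<^bsub>B\<^esub> cface T n i (fobj (Fun S) b)"
  using \<open>i \<le> n\<close>
proof (induction i arbitrary: n)
  case 0
  let ?b = "fobj (fpow (Fun T) n) b"
  have bB: "?b \<in> Ob B" using b by simp
  have "farr (Fun S) (cface T n 0 b) \<cdot>\<^bsub>B\<^esub> swl (Suc n) b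
      = (farr (Fun S) (counit T ?b) \<cdot>\<^bsub>B\<^esub> \<chi> ?b) \<cdot>\<^bsub>B\<^esub> farr (Fun T) (swl n b)"
    using b by (simp add: cface_0 B_assoc[OF T.comu.F.farr_closed[OF swap_left_hom] chi_hom
          S.comu.F.farr_closed[OF counit_T_hom]])
  also have "\<dots> = counit T (fobj (Fun S) ?b) \<cdot>\<^bsub>B\<^esub> farr (Fun T) (swl n b)"
    by (simp only: counit_T[OF bB])
  also have "\<dots> = swl n b \<cdot>\<^bsub>B\<^esub> cface T n 0 (fobj (Fun S) b)"
    using T.coun.naturality[OF swap_left_hom[OF b, of n]] by (simp add: cface_0)
  finally show ?case .
next
  case (Suc i)
  then obtain m where [simp]: "n = Suc m" and im: "i \<le> m"
    by (metis Suc_le_D Suc_le_mono)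
  let ?b = "fobj (fpow (Fun T) (Suc m)) b" and ?b' = "fobj (fpow (Fun T) m) b"
  have bB: "?b \<in> Ob B" "?b' \<in> Ob B"
    using b T.pow_Ob by blast+
  note e = T.cface_hom[OF im b] and eS = T.cface_hom[OF im S_Ob[OF b]]
  note w = swap_left_hom[OF b, of "Suc m"] and w' = swap_left_hom[OF b, of m]
  note Te = T.comu.F.farr_closed[OF e] and Se = S.comu.F.farr_closed[OF e]
  have "farr (Fun S) (cface T (Suc m) (Suc i) b) \<cdot>\<^bsub>B\<^esub> swl (Suc (Suc m)) b
      = (farr (Fun S) (farr (Fun T) (cface T m i b)) \<cdot>\<^bsub>B\<^esub> \<chi> ?b) \<cdot>\<^bsub>B\<^esub> farr (Fun T) (swl (Suc m) b)"
    unfolding cface_Suc_Suc swap_left.simps(2)[of _ _ _ _ "Suc m"]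
    by (rule B_assoc[symmetric, OF T.comu.F.farr_closed[OF w] chi_hom[OF bB(1)] S.comu.F.farr_closed[OF Te]])
  also have "\<dots> = (\<chi> ?b' \<cdot>\<^bsub>B\<^esub> farr (Fun T) (farr (Fun S) (cface T m i b))) \<cdot>\<^bsub>B\<^esub> farr (Fun T) (swl (Suc m) b)"
    using chi.naturality[OF e] by simp
  also have "\<dots> = \<chi> ?b' \<cdot>\<^bsub>B\<^esub> farr (Fun T) (farr (Fun S) (cface T m i b)) \<cdot>\<^bsub>B\<^esub> farr (Fun T) (swl (Suc m) b)"
    by (rule B_assoc[OF T.comu.F.farr_closed[OF w] T.comu.F.farr_closed[OF Se] chi_hom[OF bB(2)]])
  also have "\<dots> = \<chi> ?b' \<cdot>\<^bsub>B\<^esub> farr (Fun T) (swl m b \<cdot>\<^bsub>B\<^esub> cface T m i (fobj (Fun S) b))"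
    by (simp only: T.comu.F.farr_Cmp[OF w Se, symmetric] Suc.IH[OF im])
  also have "\<dots> = swl (Suc m) b \<cdot>\<^bsub>B\<^esub> cface T (Suc m) (Suc i) (fobj (Fun S) b)"
    unfolding cface_Suc_Suc swap_left.simps(2) T.comu.F.farr_Cmp[OF eS w']
    by (rule B_assoc[symmetric, OF T.comu.F.farr_closed[OF eS] T.comu.F.farr_closed[OF w'] chi_hom[OF bB(2)]])
  finally show ?case by simp
qed

end

section \<open>The contracting homotopies\<close>

text \<open>One comonad with coefficients on both sides is all that enters the two simplicial
  functors, so the locale can be instantiated both at \<open>T\<close> and at
  \<open>S\<close>.\<close>

locale comonad_coefficients =
  comonad B T + M: is_functor Y B M + N: is_functor B Z N + Z: abelian_category Z
  for B :: "('o, 'm, 'x) cat_scheme" and T :: "('o, 'm) cmnd"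
    and M :: "('oy, 'my, 'o, 'm) fnctr" and Y :: "('oy, 'my, 'y) cat_scheme"
    and N :: "('o, 'm, 'oz, 'mz) fnctr" and Z :: "('oz, 'mz, 'z) abcat_scheme"
begin

text \<open>The common faces of both simplicial functors, which differ only in the order of the
  faces. For \<open>n = 0\<close> the single face is the augmentation.\<close>

definition N_face :: "nat \<Rightarrow> nat \<Rightarrow> 'oy \<Rightarrow> 'mz" where
  "N_face n i y = farr N (cface T n i (fobj M y))"

lemma N_face_nat_trans:
  assumes "i \<le> n"
  shows "nat_trans Y Z (N \<odot> fpow (Fun T) (Suc n) \<odot> M) (N \<odot> fpow (Fun T) n \<odot> M) (N_face n i)"
  unfolding N_face_def[abs_def]
  by (rule nat_trans_whisker_left[OF N.is_functor_axioms
        nat_trans_whisker_right[OF cface_nat_trans[OF assms] M.is_functor_axioms]])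

lemma N_face_N_face:
  assumes "i \<le> j" "j \<le> n" "y \<in> Ob Y"
  shows "N_face n i y \<cdot>\<^bsub>Z\<^esub> N_face (Suc n) (Suc j) y = N_face n j y \<cdot>\<^bsub>Z\<^esub> N_face (Suc n) i y"
proof -
  note hom = cface_hom[OF _ M.fobj_closed[OF \<open>y \<in> Ob Y\<close>]]
  have "N_face n i y \<cdot>\<^bsub>Z\<^esub> N_face (Suc n) (Suc j) y
      = farr N (cface T n i (fobj M y) \<cdot>\<^bsub>B\<^esub> cface T (Suc n) (Suc j) (fobj M y))"
    unfolding N_face_def by (rule N.farr_Cmp[symmetric, OF hom hom]) (use assms in auto)
  also have "\<dots> = farr N (cface T n j (fobj M y) \<cdot>\<^bsub>B\<^esub> cface T (Suc n) i (fobj M y))"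
    using assms by (simp add: cface_cface M.fobj_closed)
  also have "\<dots> = N_face n j y \<cdot>\<^bsub>Z\<^esub> N_face (Suc n) i y"
    unfolding N_face_def by (rule N.farr_Cmp[OF hom hom]) (use assms in auto)
  finally show ?thesis .
qed

lemma N_face_hom:
  "\<lbrakk>i \<le> n; y \<in> Ob Y\<rbrakk> \<Longrightarrow> N_face n i y \<in> hom_set Z (fobj N (fobj (fpow (Fun T) (Suc n)) (fobj M y)))
    (fobj N (fobj (fpow (Fun T) n) (fobj M y)))"
  using nat_trans.component[OF N_face_nat_trans] by simp

text \<open>Identifies the augmentation with the boundary formula in degree 0. The map
  \<open>k\<close> covers both orders of the faces, \<open>i\<close> and
  \<open>0 - i\<close>.\<close>

lemma alt_sum_N_face_0:
  assumes "y \<in> Ob Y" and "k 0 = 0"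
  shows "alt_sum (hom_group Z (fobj N (fobj (Fun T) (fobj M y))) (fobj N (fobj M y))) (\<lambda>i. N_face 0 (k i) y) 0
      = N_face 0 0 y"
proof -
  have hom: "N_face 0 0 y \<in> hom_set Z (fobj N (fobj (Fun T) (fobj M y))) (fobj N (fobj M y))"
    using N_face_hom[of 0 0, OF _ assms(1)] assms(2) by simp
  show ?thesis
    using comm_group.alt_sum_0[OF Z.hom_comm_group, of _ _ "\<lambda>i. N_face 0 (k i) y"] N.B.hom_set_Ob[OF hom] hom assms(2)
    by simp
qed

lemma contractible_C_simp:
  assumes h: "\<And>n. nat_trans Y Z (N \<odot> fpow (Fun T) n \<odot> M) (N \<odot> fpow (Fun T) (Suc n) \<odot> M) (h n)"
    and d0h: "\<And>n y. y \<in> Ob Y \<Longrightarrow> N_face n 0 y \<cdot>\<^bsub>Z\<^esub> h n y = Ide Z (fobj N (fobj (fpow (Fun T) n) (fobj M y)))"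
    and dh: "\<And>n i y. \<lbrakk>i \<le> n; y \<in> Ob Y\<rbrakk>
      \<Longrightarrow> N_face (Suc n) (Suc i) y \<cdot>\<^bsub>Z\<^esub> h (Suc n) y = h n y \<cdot>\<^bsub>Z\<^esub> N_face n i y"
  shows "contractible_complex Y Z
    (augment (N \<odot> M) (whisker N (counit T) M) (associated_complex Z (C_simp T N M)))"
    (is "contractible_complex Y Z ?X")
proof -
  have chain: "chain ?X n = N \<odot> fpow (Fun T) n \<odot> M" for n
    by (cases n) (simp_all add: augment_def associated_complex_def C_simp_def)
  have bdry: "bdry ?X n y
      = alt_sum (hom_group Z (fobj (chain ?X (Suc n)) y) (fobj (chain ?X n) y)) (\<lambda>i. N_face n i y) n"
    if y: "y \<in> Ob Y" for n y
  proof (cases n)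
    case 0
    then show ?thesis
      using alt_sum_N_face_0[OF y, of "\<lambda>i. i"] unfolding chain
      by (simp add: augment_def whisker_def N_face_def cface_0)
  next
    case (Suc m)
    then show ?thesis
      unfolding chain by (simp add: augment_def associated_complex_def C_simp_def alt_sum_def
          whisker_def N_face_def cface_def Let_def)
  qed
  show ?thesis
    using Z.abelian_category_axioms N_face_nat_trans bdry N_face_N_face h d0h dh
    by (intro contractible_complexI[where d = N_face and h = h]) (simp_all only: chain fnctr_simps)
qed

text \<open>In the opposite order the zeroth face is \<open>N_face n n\<close>. An extra degeneracy
  must therefore be split by the innermost counit and commute with the remaining faces without a
  shift of index.\<close>

lemma contractible_Cop_simp:
  assumes h: "\<And>n. nat_trans Y Z (N \<odot> fpow (Fun T) n \<odot> M) (N \<odot> fpow (Fun T) (Suc n) \<odot> M) (h n)"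
    and d0h: "\<And>n y. y \<in> Ob Y \<Longrightarrow> N_face n n y \<cdot>\<^bsub>Z\<^esub> h n y = Ide Z (fobj N (fobj (fpow (Fun T) n) (fobj M y)))"
    and dh: "\<And>n i y. \<lbrakk>i \<le> n; y \<in> Ob Y\<rbrakk>
      \<Longrightarrow> N_face (Suc n) i y \<cdot>\<^bsub>Z\<^esub> h (Suc n) y = h n y \<cdot>\<^bsub>Z\<^esub> N_face n i y"
  shows "contractible_complex Y Z
    (augment (N \<odot> M) (whisker N (counit T) M) (associated_complex Z (Cop_simp T N M)))"
    (is "contractible_complex Y Z ?X")
proof -
  have chain: "chain ?X n = N \<odot> fpow (Fun T) n \<odot> M" for n
    by (cases n) (simp_all add: augment_def associated_complex_def Cop_simp_def)
  have bdry: "bdry ?X n y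
      = alt_sum (hom_group Z (fobj (chain ?X (Suc n)) y) (fobj (chain ?X n) y)) (\<lambda>i. N_face n (n - i) y) n"
    if y: "y \<in> Ob Y" for n y
  proof (cases n)
    case 0
    then show ?thesis
      using alt_sum_N_face_0[OF y, of "\<lambda>i. 0 - i"] unfolding chain
      by (simp add: augment_def whisker_def N_face_def cface_0)
  next
    case (Suc m)
    let ?H = "hom_group Z (fobj (chain ?X (Suc n)) y) (fobj (chain ?X n) y)"
    have "bdry ?X n y
        = alt_sum ?H (\<lambda>i. whisker (N \<odot> fpow (Fun T) (n - i)) (counit T) (fpow (Fun T) i \<odot> M) y) n"
      unfolding chain by (simp add: Suc augment_def associated_complex_def Cop_simp_def alt_sum_def Let_def)
    also have "\<dots> = alt_sum ?H (\<lambda>i. N_face n (n - i) y) n"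
    proof (rule comm_group.alt_sum_cong)
      show "comm_group ?H"
        using y unfolding chain
        by (intro Z.hom_comm_group) (simp_all del: fpow.simps add: N.fobj_closed M.fobj_closed)
      show "N_face n (n - i) y \<in> carrier ?H" if "i \<le> n" for i
        using N_face_hom[of "n - i" n y] y unfolding chain by (simp del: fpow.simps)
    qed (simp add: whisker_def N_face_def cface_def)
    finally show ?thesis .
  qed
  show ?thesis
  proof (rule contractible_complexI[where d = "\<lambda>n i. N_face n (n - i)" and h = h])
    \<comment> \<open>Reversal of indices turns \<open>i \<le> j\<close> into
      \<open>n - j \<le> n - i\<close>, and the simplicial identity for the reversed faces is the
      original one read from right to left.\<close>
    fix n i j :: nat and y assume *: "i \<le> j" "j \<le> n" "y \<in> Ob Y"
    then show "N_face n (n - i) y \<cdot>\<^bsub>Z\<^esub> N_face (Suc n) (Suc n - Suc j) y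
        = N_face n (n - j) y \<cdot>\<^bsub>Z\<^esub> N_face (Suc n) (Suc n - i) y"
      using N_face_N_face[of "n - j" "n - i" n y] by (simp add: Suc_diff_le)
  qed (use Z.abelian_category_axioms N_face_nat_trans bdry h d0h dh in
      \<open>simp_all only: chain fnctr_simps diff_le_self diff_zero diff_Suc_Suc\<close>)
qed

section \<open>Homotopies given directly by a coalgebra or opcoalgebra structure\<close>

text \<open>The structure map adds a copy of \<open>T\<close> at the left-hand end. The zeroth face
  deletes it again by the counit law; every other face has the form \<open>NT\<close> applied to a
  lower face, so naturality of \<open>nabla\<close> moves it past the structure map.\<close>

lemma contractible_of_opcoalgebra:
  assumes "opcoalgebra_structure B T N Z nabla"
  shows "contractible_complex Y Z
    (augment (N \<odot> M) (whisker N (counit T) M) (associated_complex Z (C_simp T N M)))"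
proof -
  interpret nabla: opcoalgebra_structure B T N Z nabla by fact
  let ?h = "\<lambda>n y. nabla (fobj (fpow (Fun T) n) (fobj M y))"
  show ?thesis
  proof (rule contractible_C_simp[where h = ?h])
    show "nat_trans Y Z (N \<odot> fpow (Fun T) n \<odot> M) (N \<odot> fpow (Fun T) (Suc n) \<odot> M) (?h n)" for n
      using nat_trans_whisker_right[OF nabla.nab.nat_trans_axioms
          is_functor_fcomp[OF pow_functor M.is_functor_axioms], of n]
      by (simp add: fcomp_assoc)
    show "N_face n 0 y \<cdot>\<^bsub>Z\<^esub> ?h n y = Ide Z (fobj N (fobj (fpow (Fun T) n) (fobj M y)))" if "y \<in> Ob Y" for n :: nat and y
      using that by (simp add: N_face_def cface_0 nabla.counit_nabla M.fobj_closed)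
    show "N_face (Suc n) (Suc i) y \<cdot>\<^bsub>Z\<^esub> ?h (Suc n) y = ?h n y \<cdot>\<^bsub>Z\<^esub> N_face n i y"
      if "i \<le> n" "y \<in> Ob Y" for n i :: nat and y
      unfolding N_face_def cface_Suc_Suc
      using nabla.nab.naturality[OF cface_hom[OF that(1) M.fobj_closed[OF that(2)]]] by simp
  qed
qed

text \<open>The new copy of \<open>T\<close> now appears next to \<open>M\<close> and is deleted by
  the innermost counit. The remaining faces leave it alone and commute with the homotopy by their
  own naturality, applied to the morphism \<open>nabla y\<close>.\<close>

lemma contractible_of_coalgebra:
  assumes "coalgebra_structure B T M Y nabla"
  shows "contractible_complex Y Z
    (augment (N \<odot> M) (whisker N (counit T) M) (associated_complex Z (Cop_simp T N M)))"
proof -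
  interpret nabla: coalgebra_structure B T M Y nabla by fact
  let ?h = "\<lambda>n y. farr N (farr (fpow (Fun T) n) (nabla y))"
  show ?thesis
  proof (rule contractible_Cop_simp[where h = ?h])
    show "nat_trans Y Z (N \<odot> fpow (Fun T) n \<odot> M) (N \<odot> fpow (Fun T) (Suc n) \<odot> M) (?h n)" for n
      using nat_trans_whisker_left[OF is_functor_fcomp[OF N.is_functor_axioms pow_functor]
          nabla.nab.nat_trans_axioms, of n]
      unfolding fpow_Suc_right by (simp add: fcomp_assoc)
  next
    fix n :: nat and y assume y: "y \<in> Ob Y"
    note My = M.fobj_closed[OF y]
    have nab: "nabla y \<in> hom_set B (fobj M y) (fobj (Fun T) (fobj M y))"
      using nabla.nab.component[OF y] by simp
    have e: "counit T (fobj M y) \<in> hom_set B (fobj (Fun T) (fobj M y)) (fobj M y)"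
      using coun.component[OF My] by simp
    note Tn = is_functor.farr_closed[OF pow_functor, of _ _ _ n]
    have "N_face n n y \<cdot>\<^bsub>Z\<^esub> ?h n y
        = farr N (farr (fpow (Fun T) n) (counit T (fobj M y) \<cdot>\<^bsub>B\<^esub> nabla y))"
      unfolding N_face_def cface_diag
      by (simp only: N.farr_Cmp[OF Tn[OF nab] Tn[OF e]] is_functor.farr_Cmp[OF pow_functor nab e])
    then show "N_face n n y \<cdot>\<^bsub>Z\<^esub> ?h n y = Ide Z (fobj N (fobj (fpow (Fun T) n) (fobj M y)))"
      using y My by (simp add: nabla.counit_nabla is_functor.farr_Ide[OF pow_functor] N.farr_Ide)
  next
    fix n i :: nat and y assume i: "i \<le> n" and y: "y \<in> Ob Y"
    note My = M.fobj_closed[OF y]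
    have nab: "nabla y \<in> hom_set B (fobj M y) (fobj (Fun T) (fobj M y))"
      using nabla.nab.component[OF y] by simp
    have TMy: "fobj (Fun T) (fobj M y) \<in> Ob B"
      using comu.F.A.hom_set_Ob[OF nab] by simp
    note Tn = is_functor.farr_closed[OF pow_functor nab]
    have "N_face (Suc n) i y \<cdot>\<^bsub>Z\<^esub> ?h (Suc n) y
        = farr N (cface T n i (fobj (Fun T) (fobj M y)) \<cdot>\<^bsub>B\<^esub> farr (fpow (Fun T) (Suc n)) (nabla y))"
      unfolding N_face_def cface_Suc_left[OF i]
      by (rule N.farr_Cmp[symmetric, OF Tn cface_hom[OF i TMy]])
    also have "\<dots> = farr N (farr (fpow (Fun T) n) (nabla y) \<cdot>\<^bsub>B\<^esub> cface T n i (fobj M y))"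
      by (simp only: nat_trans.naturality[OF cface_nat_trans[OF i] nab])
    also have "\<dots> = ?h n y \<cdot>\<^bsub>Z\<^esub> N_face n i y"
      unfolding N_face_def by (rule N.farr_Cmp[OF cface_hom[OF i My] Tn])
    finally show "N_face (Suc n) i y \<cdot>\<^bsub>Z\<^esub> ?h (Suc n) y = ?h n y \<cdot>\<^bsub>Z\<^esub> N_face n i y" .
  qed
qed

end

section \<open>Homotopies transported through the distributive law\<close>

text \<open>The copy of \<open>T\<close> created by \<open>nabla\<close> at the left is carried to
  \<open>M\<close> by the iterated \<chi>, where \<rho> turns it into a copy of \<open>S\<close>.
  The law \<open>counit_rho\<close>, the compatibility \<open>counit_swap_right\<close> and the
  counit law of \<open>nabla\<close> make the three stages cancel one after another against the
  innermost counit.\<close>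

lemma contractible_Cop_of_opcoalgebra:
  assumes "right_coalgebra B T S \<chi> M Y \<rho>" "opcoalgebra_structure B T N Z nabla" "abelian_category Z"
  shows "contractible_complex Y Z
    (augment (N \<odot> M) (whisker N (counit S) M) (associated_complex Z (Cop_simp S N M)))"
proof -
  interpret comonad_coefficients B S M Y N Z
  proof -
    interpret r: right_coalgebra B T S \<chi> M Y \<rho> by fact
    interpret nabla: opcoalgebra_structure B T N Z nabla by fact
    interpret abelian_category Z by fact
    show "comonad_coefficients B S M Y N Z" by unfold_locales
  qed
  interpret r: right_coalgebra B T S \<chi> M Y \<rho> by fact
  interpret nabla: opcoalgebra_structure B T N Z nabla by fact
  let ?Sn = "\<lambda>n. fpow (Fun S) n"
  let ?u = "\<lambda>n y. nabla (fobj (?Sn n) (fobj M y))"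
    and ?v = "\<lambda>n y. farr N (swap_right B T S \<chi> n (fobj M y))"
    and ?w = "\<lambda>n y. farr N (farr (?Sn n) (\<rho> y))"
  let ?h = "\<lambda>n y. ?w n y \<cdot>\<^bsub>Z\<^esub> ?v n y \<cdot>\<^bsub>Z\<^esub> ?u n y"
  show ?thesis
  proof (rule contractible_Cop_simp[where h = ?h])
    fix n :: nat
    have u: "nat_trans Y Z (N \<odot> ?Sn n \<odot> M) (N \<odot> Fun T \<odot> ?Sn n \<odot> M) (?u n)"
      using nat_trans_whisker_right[OF nabla.nab.nat_trans_axioms
          is_functor_fcomp[OF pow_functor M.is_functor_axioms], of n]
      by (simp add: fcomp_assoc)
    have v: "nat_trans Y Z (N \<odot> Fun T \<odot> ?Sn n \<odot> M) (N \<odot> ?Sn n \<odot> Fun T \<odot> M) (?v n)"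
      using nat_trans_whisker_left[OF N.is_functor_axioms
          nat_trans_whisker_right[OF r.chi.swap_right_nat_trans M.is_functor_axioms], of n]
      by (simp add: fcomp_assoc)
    have w: "nat_trans Y Z (N \<odot> ?Sn n \<odot> Fun T \<odot> M) (N \<odot> ?Sn (Suc n) \<odot> M) (?w n)"
      using nat_trans_whisker_left[OF is_functor_fcomp[OF N.is_functor_axioms pow_functor]
          r.rho.nat_trans_axioms, of n]
      unfolding fpow_Suc_right by (simp add: fcomp_assoc)
    show "nat_trans Y Z (N \<odot> ?Sn n \<odot> M) (N \<odot> ?Sn (Suc n) \<odot> M) (?h n)"
      by (rule nat_trans_vcomp[OF w nat_trans_vcomp[OF v u]])
  next
    fix n :: nat and y assume y: "y \<in> Ob Y"
    note My = M.fobj_closed[OF y]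
    note b = is_functor.fobj_closed[OF pow_functor My]
    have u: "?u n y \<in> hom_set Z (fobj N (fobj (?Sn n) (fobj M y))) (fobj N (fobj (Fun T) (fobj (?Sn n) (fobj M y))))"
      using nabla.nab.component[OF b] by simp
    note v' = r.chi.swap_right_hom[OF My, of n]
    note v = N.farr_closed[OF v']
    have rho: "\<rho> y \<in> hom_set B (fobj (Fun T) (fobj M y)) (fobj (Fun S) (fobj M y))"
      using r.rho.component[OF y] by simp
    note w' = is_functor.farr_closed[OF pow_functor rho, of n]
    note w = N.farr_closed[OF w']
    note e' = is_functor.farr_closed[OF pow_functor r.chi.counit_S_hom[OF My], of n]
    note e = N.farr_closed[OF e']
    note eT' = is_functor.farr_closed[OF pow_functor r.chi.counit_T_hom[OF My], of n]
    note vu = N.B.Cmp_closed[OF u v]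
    have "N_face n n y \<cdot>\<^bsub>Z\<^esub> ?h n y
        = farr N (farr (?Sn n) (counit S (fobj M y)) \<cdot>\<^bsub>B\<^esub> farr (?Sn n) (\<rho> y)) \<cdot>\<^bsub>Z\<^esub> (?v n y \<cdot>\<^bsub>Z\<^esub> ?u n y)"
      unfolding N_face_def cface_diag N.farr_Cmp[OF w' e'] by (rule N.B.Cmp_assoc[OF vu w e, symmetric])
    \<comment> \<open>By \<open>counit_rho\<close> the counit of \<open>S\<close> after \<rho>
      becomes the counit of \<open>T\<close>, which can then be pulled back to the left-hand
      end.\<close>
    also have "\<dots> = farr N (farr (?Sn n) (counit T (fobj M y))) \<cdot>\<^bsub>Z\<^esub> (?v n y \<cdot>\<^bsub>Z\<^esub> ?u n y)"
      using is_functor.farr_Cmp[OF pow_functor rho r.chi.counit_S_hom[OF My], of n] y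
      by (simp add: r.counit_rho)
    also have "\<dots> = farr N (farr (?Sn n) (counit T (fobj M y)) \<cdot>\<^bsub>B\<^esub> swap_right B T S \<chi> n (fobj M y)) \<cdot>\<^bsub>Z\<^esub> ?u n y"
      unfolding N.farr_Cmp[OF v' eT'] by (rule N.B.Cmp_assoc[OF u v N.farr_closed[OF eT'], symmetric])
    also have "\<dots> = Ide Z (fobj N (fobj (?Sn n) (fobj M y)))"
      using b My by (simp add: r.chi.counit_swap_right nabla.counit_nabla)
    finally show "N_face n n y \<cdot>\<^bsub>Z\<^esub> ?h n y = Ide Z (fobj N (fobj (?Sn n) (fobj M y)))" .
  next
    fix n i :: nat and y assume i: "i \<le> n" and y: "y \<in> Ob Y"
    note My = M.fobj_closed[OF y]
    note b = is_functor.fobj_closed[OF pow_functor My]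
    note TMy = r.chi.T_Ob[OF My] and SMy = r.chi.S_Ob[OF My]
    have u: "?u n y \<in> hom_set Z (fobj N (fobj (?Sn n) (fobj M y))) (fobj N (fobj (Fun T) (fobj (?Sn n) (fobj M y))))" for n :: nat
      using nabla.nab.component[OF b] by simp
    note v' = r.chi.swap_right_hom[OF My]
    note v = N.farr_closed[OF v']
    have rho: "\<rho> y \<in> hom_set B (fobj (Fun T) (fobj M y)) (fobj (Fun S) (fobj M y))"
      using r.rho.component[OF y] by simp
    note w' = is_functor.farr_closed[OF pow_functor rho]
    note w = N.farr_closed[OF w']
    note vu = N.B.Cmp_closed[OF u v]
    note e = cface_hom[OF i My] and eT = cface_hom[OF i TMy] and eS = cface_hom[OF i SMy]
    note Te = r.chi.T.comu.F.farr_closed[OF e]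
    let ?e = "cface S n i (fobj M y)" and ?eT = "cface S n i (fobj (Fun T) (fobj M y))"
    have "N_face (Suc n) i y \<cdot>\<^bsub>Z\<^esub> ?h (Suc n) y
        = farr N (cface S n i (fobj (Fun S) (fobj M y)) \<cdot>\<^bsub>B\<^esub> farr (?Sn (Suc n)) (\<rho> y)) \<cdot>\<^bsub>Z\<^esub> (?v (Suc n) y \<cdot>\<^bsub>Z\<^esub> ?u (Suc n) y)"
      unfolding N_face_def cface_Suc_left[OF i] N.farr_Cmp[OF w' eS]
      by (rule N.B.Cmp_assoc[OF vu w N.farr_closed[OF eS], symmetric])
    \<comment> \<open>The face now travels through the three factors of the homotopy: past \<rho> by
      its own naturality, past the iterated \<chi> by \<open>cface_swap_right\<close>, and past
      \<open>nabla\<close> by naturality of \<open>nabla\<close>.\<close>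
    also have "\<dots> = farr N (farr (?Sn n) (\<rho> y) \<cdot>\<^bsub>B\<^esub> ?eT) \<cdot>\<^bsub>Z\<^esub> (?v (Suc n) y \<cdot>\<^bsub>Z\<^esub> ?u (Suc n) y)"
      by (simp only: nat_trans.naturality[OF cface_nat_trans[OF i] rho])
    also have "\<dots> = ?w n y \<cdot>\<^bsub>Z\<^esub> farr N ?eT \<cdot>\<^bsub>Z\<^esub> (?v (Suc n) y \<cdot>\<^bsub>Z\<^esub> ?u (Suc n) y)"
      unfolding N.farr_Cmp[OF eT w'] by (rule N.B.Cmp_assoc[OF vu N.farr_closed[OF eT] w])
    also have "\<dots> = ?w n y \<cdot>\<^bsub>Z\<^esub> farr N (?eT \<cdot>\<^bsub>B\<^esub> swap_right B T S \<chi> (Suc n) (fobj M y)) \<cdot>\<^bsub>Z\<^esub> ?u (Suc n) y"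
      unfolding N.farr_Cmp[OF v' eT]
      by (simp only: N.B.Cmp_assoc[OF u v N.farr_closed[OF eT]])
    also have "\<dots> = ?w n y \<cdot>\<^bsub>Z\<^esub> farr N (swap_right B T S \<chi> n (fobj M y) \<cdot>\<^bsub>B\<^esub> farr (Fun T) ?e) \<cdot>\<^bsub>Z\<^esub> ?u (Suc n) y"
      by (simp only: r.chi.cface_swap_right[OF My i])
    also have "\<dots> = ?w n y \<cdot>\<^bsub>Z\<^esub> ?v n y \<cdot>\<^bsub>Z\<^esub> farr N (farr (Fun T) ?e) \<cdot>\<^bsub>Z\<^esub> ?u (Suc n) y"
      unfolding N.farr_Cmp[OF Te v'] by (simp only: N.B.Cmp_assoc[OF u N.farr_closed[OF Te] v])
    also have "\<dots> = ?w n y \<cdot>\<^bsub>Z\<^esub> ?v n y \<cdot>\<^bsub>Z\<^esub> ?u n y \<cdot>\<^bsub>Z\<^esub> farr N ?e"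
      using nabla.nab.naturality[OF e] by simp
    also have "\<dots> = ?h n y \<cdot>\<^bsub>Z\<^esub> N_face n i y"
      unfolding N_face_def
      by (simp only: N.B.Cmp_assoc[OF N.farr_closed[OF e] u v] N.B.Cmp_assoc[OF N.farr_closed[OF e] vu w])
    finally show "N_face (Suc n) i y \<cdot>\<^bsub>Z\<^esub> ?h (Suc n) y = ?h n y \<cdot>\<^bsub>Z\<^esub> N_face n i y" .
  qed
qed

text \<open>Dually, \<open>nabla\<close> creates a copy of \<open>S\<close> next to
  \<open>M\<close>, the iterated \<chi> carries it to the left, and \<open>lam\<close> turns it into
  a copy of \<open>T\<close>. The outermost counit of \<open>T\<close> becomes one of
  \<open>S\<close> by \<open>counit_lam\<close>, moves to the right by
  \<open>counit_swap_left\<close>, and cancels \<open>nabla\<close>.\<close>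

lemma contractible_C_of_coalgebra:
  assumes "left_coalgebra B T S \<chi> N Z lam" "coalgebra_structure B S M Y nabla" "abelian_category Z"
  shows "contractible_complex Y Z
    (augment (N \<odot> M) (whisker N (counit T) M) (associated_complex Z (C_simp T N M)))"
proof -
  interpret comonad_coefficients B T M Y N Z
  proof -
    interpret l: left_coalgebra B T S \<chi> N Z lam by fact
    interpret nabla: coalgebra_structure B S M Y nabla by fact
    interpret abelian_category Z by fact
    show "comonad_coefficients B T M Y N Z" by unfold_locales
  qed
  interpret l: left_coalgebra B T S \<chi> N Z lam by fact
  interpret nabla: coalgebra_structure B S M Y nabla by fact
  let ?Tn = "\<lambda>n. fpow (Fun T) n"
  let ?u = "\<lambda>n y. farr N (farr (?Tn n) (nabla y))"
    and ?v = "\<lambda>n y. farr N (swap_left B T S \<chi> n (fobj M y))"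
    and ?w = "\<lambda>n y. lam (fobj (?Tn n) (fobj M y))"
  let ?h = "\<lambda>n y. ?w n y \<cdot>\<^bsub>Z\<^esub> ?v n y \<cdot>\<^bsub>Z\<^esub> ?u n y"
  have nab: "nabla y \<in> hom_set B (fobj M y) (fobj (Fun S) (fobj M y))" if "y \<in> Ob Y" for y
    using nabla.nab.component[OF that] by simp
  have w: "?w n y \<in> hom_set Z (fobj N (fobj (Fun S) (fobj (?Tn n) (fobj M y)))) (fobj N (fobj (?Tn (Suc n)) (fobj M y)))"
    if "y \<in> Ob Y" for n :: nat and y
    using l.lam_nt.component[OF pow_Ob[OF M.fobj_closed[OF that]]] by simp
  show ?thesis
  proof (rule contractible_C_simp[where h = ?h])
    fix n :: nat
    have u: "nat_trans Y Z (N \<odot> ?Tn n \<odot> M) (N \<odot> ?Tn n \<odot> Fun S \<odot> M) (?u n)"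
      using nat_trans_whisker_left[OF is_functor_fcomp[OF N.is_functor_axioms pow_functor]
          nabla.nab.nat_trans_axioms, of n]
      by (simp add: fcomp_assoc)
    have v: "nat_trans Y Z (N \<odot> ?Tn n \<odot> Fun S \<odot> M) (N \<odot> Fun S \<odot> ?Tn n \<odot> M) (?v n)"
      using nat_trans_whisker_left[OF N.is_functor_axioms
          nat_trans_whisker_right[OF l.chi.swap_left_nat_trans M.is_functor_axioms], of n]
      by (simp add: fcomp_assoc)
    have w: "nat_trans Y Z (N \<odot> Fun S \<odot> ?Tn n \<odot> M) (N \<odot> ?Tn (Suc n) \<odot> M) (?w n)"
      using nat_trans_whisker_right[OF l.lam_nt.nat_trans_axioms
          is_functor_fcomp[OF pow_functor M.is_functor_axioms], of n]
      by (simp add: fcomp_assoc)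
    show "nat_trans Y Z (N \<odot> ?Tn n \<odot> M) (N \<odot> ?Tn (Suc n) \<odot> M) (?h n)"
      by (rule nat_trans_vcomp[OF w nat_trans_vcomp[OF v u]])
  next
    fix n :: nat and y assume y: "y \<in> Ob Y"
    note My = M.fobj_closed[OF y]
    note b = pow_Ob[OF My, of n]
    note u' = is_functor.farr_closed[OF pow_functor nab[OF y], of n]
    note u = N.farr_closed[OF u']
    note v' = l.chi.swap_left_hom[OF My, of n]
    note v = N.farr_closed[OF v']
    note e' = l.chi.counit_S_hom[OF b] and eT = N.farr_closed[OF l.chi.counit_T_hom[OF b]]
    note w = w[OF y, of n, unfolded fpow.simps fnctr_simps]
    have "N_face n 0 y \<cdot>\<^bsub>Z\<^esub> ?h n y
        = farr N (counit S (fobj (?Tn n) (fobj M y))) \<cdot>\<^bsub>Z\<^esub> (?v n y \<cdot>\<^bsub>Z\<^esub> ?u n y)"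
      unfolding N_face_def cface_0 l.counit_lam[OF b, symmetric]
      by (rule N.B.Cmp_assoc[OF N.B.Cmp_closed[OF u v] w eT, symmetric])
    also have "\<dots> = farr N (counit S (fobj (?Tn n) (fobj M y)) \<cdot>\<^bsub>B\<^esub> swap_left B T S \<chi> n (fobj M y)) \<cdot>\<^bsub>Z\<^esub> ?u n y"
      unfolding N.farr_Cmp[OF v' e'] by (rule N.B.Cmp_assoc[OF u v N.farr_closed[OF e'], symmetric])
    also have "\<dots> = farr N (farr (?Tn n) (counit S (fobj M y)) \<cdot>\<^bsub>B\<^esub> farr (?Tn n) (nabla y))"
      unfolding l.chi.counit_swap_left[OF My]
      by (rule N.farr_Cmp[symmetric, OF u' is_functor.farr_closed[OF pow_functor l.chi.counit_S_hom[OF My]]])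
    also have "\<dots> = Ide Z (fobj N (fobj (?Tn n) (fobj M y)))"
      using b My y is_functor.farr_Cmp[OF pow_functor nab[OF y] l.chi.counit_S_hom[OF My], of n, symmetric]
      by (simp add: nabla.counit_nabla is_functor.farr_Ide[OF pow_functor] N.farr_Ide)
    finally show "N_face n 0 y \<cdot>\<^bsub>Z\<^esub> ?h n y = Ide Z (fobj N (fobj (?Tn n) (fobj M y)))" .
  next
    fix n i :: nat and y assume i: "i \<le> n" and y: "y \<in> Ob Y"
    note My = M.fobj_closed[OF y]
    note SMy = l.chi.S_Ob[OF My]
    note u' = is_functor.farr_closed[OF pow_functor nab[OF y]]
    note u = N.farr_closed[OF u']
    note v' = l.chi.swap_left_hom[OF My]
    note v = N.farr_closed[OF v']
    note w = w[OF y]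
    note vu = N.B.Cmp_closed[OF u v]
    note e = cface_hom[OF i My] and eS = cface_hom[OF i SMy]
    note Se = l.chi.S.comu.F.farr_closed[OF e] and Te = comu.F.farr_closed[OF e]
    have NTe: "farr N (farr (Fun T) (cface T n i (fobj M y))) \<in> hom_set Z
        (fobj N (fobj (?Tn (Suc (Suc n))) (fobj M y))) (fobj N (fobj (?Tn (Suc n)) (fobj M y)))"
      using N.farr_closed[OF Te] by simp
    let ?e = "cface T n i (fobj M y)" and ?eS = "cface T n i (fobj (Fun S) (fobj M y))"
    have "N_face (Suc n) (Suc i) y \<cdot>\<^bsub>Z\<^esub> ?h (Suc n) y
        = (farr N (farr (Fun T) ?e) \<cdot>\<^bsub>Z\<^esub> ?w (Suc n) y) \<cdot>\<^bsub>Z\<^esub> (?v (Suc n) y \<cdot>\<^bsub>Z\<^esub> ?u (Suc n) y)"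
      unfolding N_face_def cface_Suc_Suc
      by (rule N.B.Cmp_assoc[OF vu w NTe, symmetric])
    \<comment> \<open>The higher faces pass \<open>lam\<close> by its naturality, then the iterated
      \<chi> by \<open>cface_swap_left\<close>, and finally \<open>nabla\<close> by naturality of
      the face.\<close>
    also have "\<dots> = (?w n y \<cdot>\<^bsub>Z\<^esub> farr N (farr (Fun S) ?e)) \<cdot>\<^bsub>Z\<^esub> (?v (Suc n) y \<cdot>\<^bsub>Z\<^esub> ?u (Suc n) y)"
      using l.lam_nt.naturality[OF e] by simp
    also have "\<dots> = ?w n y \<cdot>\<^bsub>Z\<^esub> farr N (farr (Fun S) ?e) \<cdot>\<^bsub>Z\<^esub> (?v (Suc n) y \<cdot>\<^bsub>Z\<^esub> ?u (Suc n) y)"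
      by (rule N.B.Cmp_assoc[OF vu N.farr_closed[OF Se] w])
    also have "\<dots> = ?w n y \<cdot>\<^bsub>Z\<^esub> farr N (farr (Fun S) ?e \<cdot>\<^bsub>B\<^esub> swap_left B T S \<chi> (Suc n) (fobj M y)) \<cdot>\<^bsub>Z\<^esub> ?u (Suc n) y"
      unfolding N.farr_Cmp[OF v' Se]
      by (simp only: N.B.Cmp_assoc[OF u v N.farr_closed[OF Se]])
    also have "\<dots> = ?w n y \<cdot>\<^bsub>Z\<^esub> farr N (swap_left B T S \<chi> n (fobj M y) \<cdot>\<^bsub>B\<^esub> ?eS) \<cdot>\<^bsub>Z\<^esub> ?u (Suc n) y"
      by (simp only: l.chi.cface_swap_left[OF My i])
    also have "\<dots> = ?w n y \<cdot>\<^bsub>Z\<^esub> ?v n y \<cdot>\<^bsub>Z\<^esub> farr N (?eS \<cdot>\<^bsub>B\<^esub> farr (?Tn (Suc n)) (nabla y))"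
      unfolding N.farr_Cmp[OF eS v'] N.farr_Cmp[OF u' eS]
      by (simp only: N.B.Cmp_assoc[OF u N.farr_closed[OF eS] v])
    also have "\<dots> = ?w n y \<cdot>\<^bsub>Z\<^esub> ?v n y \<cdot>\<^bsub>Z\<^esub> ?u n y \<cdot>\<^bsub>Z\<^esub> farr N ?e"
      by (simp only: nat_trans.naturality[OF cface_nat_trans[OF i] nab[OF y]] N.farr_Cmp[OF e u'])
    also have "\<dots> = ?h n y \<cdot>\<^bsub>Z\<^esub> N_face n i y"
      unfolding N_face_def
      by (simp only: N.B.Cmp_assoc[OF N.farr_closed[OF e] u v] N.B.Cmp_assoc[OF N.farr_closed[OF e] vu w])
    finally show "N_face (Suc n) (Suc i) y \<cdot>\<^bsub>Z\<^esub> ?h (Suc n) y = ?h n y \<cdot>\<^bsub>Z\<^esub> N_face n i y" .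
  qed
qed

theorem proposition4p5:
  fixes B :: "('o, 'm, 'x) cat_scheme"
    and Y :: "('oy, 'my, 'y) cat_scheme"
    and Z :: "('oz, 'mz, 'z) abcat_scheme"
    and T :: "('o, 'm) cmnd" and S :: "('o, 'm) cmnd"
    and \<chi> :: "'o \<Rightarrow> 'm"
    and M :: "('oy, 'my, 'o, 'm) fnctr" and \<rho> :: "'oy \<Rightarrow> 'm"
    and N :: "('o, 'm, 'oz, 'mz) fnctr" and lam :: "'o \<Rightarrow> 'mz"
  assumes "distributive_law B T S \<chi>"
    and "right_coalgebra B T S \<chi> M Y \<rho>"
    and "left_coalgebra B T S \<chi> N Z lam"
    and "abelian_category Z"
    and "entwined_left B T S N Z lam \<or> entwined_right B T S M Y \<rho>"
  shows "contractible_complex Y Z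
        (augment (N \<odot> M) (whisker N (counit T) M) (associated_complex Z (C_simp T N M)))
    \<and> contractible_complex Y Z
        (augment (N \<odot> M) (whisker N (counit S) M) (associated_complex Z (Cop_simp S N M)))"
proof -
  interpret r: right_coalgebra B T S \<chi> M Y \<rho> by fact
  interpret l: left_coalgebra B T S \<chi> N Z lam by fact
  interpret abelian_category Z by fact
  interpret T: comonad_coefficients B T M Y N Z by unfold_locales
  interpret S: comonad_coefficients B S M Y N Z by unfold_locales
  \<comment> \<open>In each case \<open>nabla\<close> gives one complex a homotopy directly: that of
    \<open>T\<close> in the left case, that of \<open>S\<close> in the right case. The other complex
    receives it through \<chi> and the coalgebra on the opposite side.\<close>
  from assms(5) show ?thesis
  proof
    assume "entwined_left B T S N Z lam"
    then obtain nabla where "opcoalgebra_structure B T N Z nabla"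
      by (auto simp: entwined_left_def)
    then show ?thesis
      using T.contractible_of_opcoalgebra contractible_Cop_of_opcoalgebra[OF assms(2) _ assms(4)] by blast
  next
    assume "entwined_right B T S M Y \<rho>"
    then obtain nabla where "coalgebra_structure B S M Y nabla"
      by (auto simp: entwined_right_def)
    then show ?thesis
      using S.contractible_of_coalgebra contractible_C_of_coalgebra[OF assms(3) _ assms(4)] by blast
  qed
qed

end
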